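(* Let $(a,b)$ be a bounded interval, let $\{\mathcal{T}_h\}_h$ be a quasi-uniform family of subdivisions of $(a,b)$, where $h$ denotes the minimum length of the cells of $\mathcal{T}_h$, let $p\ge1$ be an integer and $\omega\in\mathbb{R}$. In the Neumann case let $\mathbf{Y}_{0:p}=\mathbf{C}_{0:p}$ and assume $\omega\neq0$; in the (zero) Dirichlet case let $\mathbf{Y}_{0:p}=\mathbf{Q}_{0:p}$. Let $L$ satisfy $$L^\top L = A_{Y,p} := -\Delta_{Y,p}+\frac{\omega^2}{2}M_{Y,p}.$$ Then $$\sigma\bigl(L^{-\top}M_{Y,p}L^{-1}\bigr)\subseteq\left[\frac{2h^2}{24p^4+\omega^2h^2},\,C\right],$$ where $C=\min\bigl((b-a)^2/\pi^2,\ \max(1,2/\omega^2)\bigr)$ in the Dirichlet case (with $2/\omega^2$ read as $+\infty$ if $\omega=0$) and $C=\max(1,2/\omega^2)$ in the Neumann case.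
   Context: $\sigma$ denotes the spectrum of a matrix. A family of subdivisions is quasi-uniform if there is $\rho>0$, independent of the subdivision, such that every cell length is at most $\rho^{-1}$ times the minimum cell length of that subdivision. For a subdivision $a=x_0<x_1<\dots<x_n=b$, let $h_0,\dots,h_n$ be the continuous piecewise linear hat functions with $h_j(x_i)=\delta_{ij}$. Let $P_k$ be the Legendre polynomials and $W_k=\frac{1}{2k+3}(P_k-P_{k+2})$ for $k\ge0$ (so $W_k(\pm1)=0$ and $W_k'=-P_{k+1}$). With $a_j(x)=\frac{2x-x_{j-1}-x_j}{x_j-x_{j-1}}$, the bubble functions are $W_{kj}(x)=W_k(a_j(x))$ for $x\in[x_{j-1},x_j]$ and $0$ otherwise ($j=1,\dots,n$). The bases (row vectors of functions) up to degree $p$ are $$\mathbf{C}_{0:p}=[h_0,\dots,h_n\,|\,W_{01},\dots,W_{0n}\,|\,\cdots\,|\,W_{p-2,1},\dots,W_{p-2,n}],$$ $$\mathbf{Q}_{0:p}=[h_1,\dots,h_{n-1}\,|\,W_{01},\dots,W_{0n}\,|\,\cdots\,|\,W_{p-2,1},\dots,W_{p-2,n}]$$ (no bubble functions if $p=1$). Thus $\mathbf{C}_{0:p}$ spans the continuous piecewise polynomials of degree at most $p$ on the subdivision, and $\mathbf{Q}_{0:p}$ those vanishing at $a$ and $b$; the basis is assumed nonempty. For $\mathbf{Y}_{0:p}=[y_1,\dots,y_N]$ equal to either basis, the mass matrix and weak Laplacian are $$(M_{Y,p})_{ij}=\int_a^b y_i y_j\,dx,\qquad (-\Delta_{Y,p})_{ij}=\int_a^b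 y_i' y_j'\,dx .$$ *)

theory Defs
  imports
    "HOL-Analysis.Analysis"
    "HOL-Computational_Algebra.Polynomial"
    "Jordan_Normal_Form.Gauss_Jordan_Elimination"
    "Jordan_Normal_Form.Spectral_Radius"
begin

section \<open>Subdivisions\<close>

text \<open>The subdivision a = x_0 < ... < x_n = b is the list [x_0, ..., x_n] of its nodes, so
  n = length xs - 1.\<close>

definition subdivision :: "real \<Rightarrow> real \<Rightarrow> real list \<Rightarrow> bool" where
  "subdivision a b xs \<longleftrightarrow>
     2 \<le> length xs \<and> sorted_wrt (<) xs \<and> hd xs = a \<and> last xs = b"

definition ncells :: "real list \<Rightarrow> nat" where
  "ncells xs = length xs - 1"

text \<open>Cells are numbered from 1: cell j is the interval from x_{j-1} to x_j.\<close>

definition cell_length :: "real list \<Rightarrow> nat \<Rightarrow> real" where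
  "cell_length xs j = xs ! j - xs ! (j - 1)"

definition min_length :: "real list \<Rightarrow> real" where
  "min_length xs = Min (cell_length xs ` {1..ncells xs})"

definition quasi_uniform :: "real list set \<Rightarrow> bool" where
  "quasi_uniform \<T> \<longleftrightarrow>
     (\<exists>\<rho>>0. \<forall>xs\<in>\<T>. \<forall>j\<in>{1..ncells xs}. cell_length xs j \<le> inverse \<rho> * min_length xs)"

section \<open>Hat and bubble functions\<close>

definition hat :: "real list \<Rightarrow> nat \<Rightarrow> real \<Rightarrow> real" where
  "hat xs j x =
     (if 1 \<le> j \<and> xs ! (j - 1) \<le> x \<and> x \<le> xs ! j
        then (x - xs ! (j - 1)) / (xs ! j - xs ! (j - 1))
      else if j < ncells xs \<and> xs ! j \<le> x \<and> x \<le> xs ! (j + 1)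
        then (xs ! (j + 1) - x) / (xs ! (j + 1) - xs ! j)
      else 0)"

text \<open>Legendre polynomials, normalised to 1 at 1, by Bonnet's recursion
  (k + 2) P_{k+2} = (2 k + 3) x P_{k+1} - (k + 1) P_k.\<close>

fun legendre :: "nat \<Rightarrow> real poly" where
  "legendre 0 = 1"
| "legendre (Suc 0) = [:0, 1:]"
| "legendre (Suc (Suc k)) =
     Polynomial.smult (1 / (real k + 2))
       (Polynomial.smult (2 * real k + 3) ([:0, 1:] * legendre (Suc k)) - Polynomial.smult (real k + 1) (legendre k))"

definition bubble_poly :: "nat \<Rightarrow> real poly" where
  "bubble_poly k = Polynomial.smult (1 / (2 * real k + 3)) (legendre k - legendre (k + 2))"

definition cell_map :: "real list \<Rightarrow> nat \<Rightarrow> real \<Rightarrow> real" where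
  "cell_map xs j x = (2 * x - xs ! (j - 1) - xs ! j) / (xs ! j - xs ! (j - 1))"

definition bubble :: "real list \<Rightarrow> nat \<Rightarrow> nat \<Rightarrow> real \<Rightarrow> real" where
  "bubble xs k j x =
     (if xs ! (j - 1) \<le> x \<and> x \<le> xs ! j then poly (bubble_poly k) (cell_map xs j x) else 0)"

section \<open>Bases\<close>

text \<open>The range [0..<p - 1] is 0, ..., p - 2 and is empty for p = 1.\<close>

definition bubbles :: "nat \<Rightarrow> real list \<Rightarrow> (real \<Rightarrow> real) list" where
  "bubbles p xs = concat (map (\<lambda>k. map (bubble xs k) [1..<ncells xs + 1]) [0..<p - 1])"

definition C_basis :: "nat \<Rightarrow> real list \<Rightarrow> (real \<Rightarrow> real) list" where
  "C_basis p xs = map (hat xs) [0..<ncells xs + 1] @ bubbles p xs"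

definition Q_basis :: "nat \<Rightarrow> real list \<Rightarrow> (real \<Rightarrow> real) list" where
  "Q_basis p xs = map (hat xs) [1..<ncells xs] @ bubbles p xs"

datatype bdry_cond = Neumann | Dirichlet

fun basis :: "bdry_cond \<Rightarrow> nat \<Rightarrow> real list \<Rightarrow> (real \<Rightarrow> real) list" where
  "basis Neumann p xs = C_basis p xs"
| "basis Dirichlet p xs = Q_basis p xs"

section \<open>Mass matrix, weak Laplacian and inverse\<close>

definition mass_matrix :: "real \<Rightarrow> real \<Rightarrow> (real \<Rightarrow> real) list \<Rightarrow> real mat" where
  "mass_matrix a b Y =
     Matrix.mat (length Y) (length Y)
       (\<lambda>(i, j). integral {a..b} (\<lambda>x. (Y ! i) x * (Y ! j) x))"

text \<open>The basis functions are piecewise polynomial, so their weak derivative is the pointwise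
  one away from the nodes. The value of \<^const>\<open>deriv\<close> at the finitely many nodes, where it
  may be arbitrary, does not affect the integral.\<close>

definition weak_laplacian :: "real \<Rightarrow> real \<Rightarrow> (real \<Rightarrow> real) list \<Rightarrow> real mat" where
  "weak_laplacian a b Y =
     Matrix.mat (length Y) (length Y)
       (\<lambda>(i, j). integral {a..b} (\<lambda>x. deriv (Y ! i) x * deriv (Y ! j) x))"

text \<open>\<^const>\<open>mat_inverse\<close> is option-valued; this is meaningful for invertible matrices only.\<close>

definition inv_mat :: "real mat \<Rightarrow> real mat" where
  "inv_mat L = the (mat_inverse L)"

section \<open>The upper bound\<close>

text \<open>For \<omega> = 0 the term 2 / \<omega>^2 stands for infinity, so that the minimum is its first
  argument (whereas HOL division by zero would give 0).\<close>

fun upper_const :: "bdry_cond \<Rightarrow> real \<Rightarrow> real \<Rightarrow> real \<Rightarrow> real" where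
  "upper_const Neumann a b \<omega> = max 1 (2 / \<omega>\<^sup>2)"
| "upper_const Dirichlet a b \<omega> =
     (if \<omega> = 0 then (b - a)\<^sup>2 / pi\<^sup>2 else min ((b - a)\<^sup>2 / pi\<^sup>2) (max 1 (2 / \<omega>\<^sup>2)))"

end

theory Submission
  imports Defs
begin

text \<open>
  The eigenvalues in question are the Rayleigh quotients of \<open>M\<close> with respect to \<open>A = L\<^sup>T L\<close>,
  that is \<open>\<parallel>u\<parallel>\<^sup>2 / (\<parallel>u'\<parallel>\<^sup>2 + \<omega>\<^sup>2/2 \<parallel>u\<parallel>\<^sup>2)\<close> for \<open>u\<close> in the span of the basis. The lower
  bound is the inverse inequality \<open>\<parallel>u'\<parallel>\<^sup>2 \<le> 12 p\<^sup>4/h\<^sup>2 \<parallel>u\<parallel>\<^sup>2\<close>, which on each cell follows by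
  splitting off one Legendre polynomial at a time. The upper bound is trivial if \<open>\<omega> \<noteq> 0\<close>, except
  for the constant \<open>(b - a)\<^sup>2/\<pi>\<^sup>2\<close> of the Dirichlet case: this is Wirtinger's inequality, obtained on
  each cell from a Riccati equation, with boundary terms that telescope over the cells.
\<close>

section \<open>Legendre polynomials and the inverse inequality\<close>

lemma poly_ext:
  fixes q r :: "real poly"
  assumes "\<And>x. poly q x = poly r x"
  shows "q = r"
  using assms poly_eq_poly_eq_iff by blast

section \<open>Recurrences, endpoint values and differential equation of the Legendre
  polynomials\<close>

lemma legendre_recurrence:
  "(real k + 2) * poly (legendre (k + 2)) x =
     (2 * real k + 3) * x * poly (legendre (Suc k)) x - (real k + 1) * poly (legendre k) x"
  by (simp add: field_simps)

lemma pderiv_legendre_recurrence: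
  "(real k + 2) * poly (pderiv (legendre (k + 2))) x =
     (2 * real k + 3) * (poly (legendre (Suc k)) x + x * poly (pderiv (legendre (Suc k))) x)
     - (real k + 1) * poly (pderiv (legendre k)) x"
  by (simp add: pderiv_smult pderiv_diff pderiv_mult pderiv_pCons) (simp add: field_simps)

text \<open>Neither identity is inductive alone. Eliminating \<open>P' k\<close> from the
  differentiated Bonnet recursion by the second identity gives the first one at the next index; the
  second one there follows from this, Bonnet's recursion and both old identities.\<close>

lemma legendre_deriv_step:
  "poly (pderiv (legendre (Suc k))) x =
     x * poly (pderiv (legendre k)) x + (real k + 1) * poly (legendre k) x \<and>
   x * poly (pderiv (legendre (Suc k))) x =
     poly (pderiv (legendre k)) x + (real k + 1) * poly (legendre (Suc k)) x"
proof (induction k)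
  case 0
  show ?case by (simp add: pderiv_pCons)
next
  case (Suc k)
  define P where "P j = poly (legendre j) x" for j
  define P' where "P' j = poly (pderiv (legendre j)) x" for j
  have rec: "(real k + 2) * P (k + 2) = (2 * real k + 3) * x * P (Suc k) - (real k + 1) * P k"
    unfolding P_def by (rule legendre_recurrence)
  have rec': "(real k + 2) * P' (k + 2) =
      (2 * real k + 3) * (P (Suc k) + x * P' (Suc k)) - (real k + 1) * P' k"
    unfolding P_def P'_def by (rule pderiv_legendre_recurrence)
  have a: "P' (Suc k) = x * P' k + (real k + 1) * P k"
    and b: "x * P' (Suc k) = P' k + (real k + 1) * P (Suc k)"
    using Suc.IH by (auto simp: P_def P'_def)
  have b': "P' k = x * P' (Suc k) - (real k + 1) * P (Suc k)" using b by simp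
  have "(real k + 2) * P' (k + 2) = (real k + 2) * (x * P' (Suc k) + (real k + 2) * P (Suc k))"
    unfolding rec' b' by (simp add: algebra_simps)
  then have a2: "P' (k + 2) = x * P' (Suc k) + (real k + 2) * P (Suc k)" by simp
  have "x * P' (k + 2) = x * (P' k + (real k + 1) * P (Suc k)) + (real k + 2) * x * P (Suc k)"
    unfolding a2 b by (simp add: algebra_simps)
  also have "\<dots> = P' (Suc k) + (real k + 2) * P (k + 2)"
    unfolding rec a by (simp add: algebra_simps)
  finally have b2: "x * P' (k + 2) = P' (Suc k) + (real k + 2) * P (k + 2)" .
  show ?case using a2 b2 by (simp add: P_def P'_def del: legendre.simps)
qed

lemma legendre_at_1: "poly (legendre k) 1 = 1"
proof (induction k rule: legendre.induct)
  case (3 k)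
  then show ?case using legendre_recurrence[of k 1] by (simp del: legendre.simps)
qed auto

lemma legendre_at_minus_1: "poly (legendre k) (-1) = (-1) ^ k"
proof (induction k rule: legendre.induct)
  case (3 k)
  then have "(real k + 2) * poly (legendre (k + 2)) (-1) = (real k + 2) * (-1) ^ k"
    using legendre_recurrence[of k "-1"] by (simp del: legendre.simps add: algebra_simps)
  then show ?case by (simp del: legendre.simps)
qed auto

text \<open>Each step of the recursion multiplies the leading coefficient by (2k + 3)/(k + 2). That
  it is nonzero is what allows the top coefficient of a polynomial to be cancelled by a multiple of
  a Legendre polynomial.\<close>

lemma degree_coeff_legendre:
  "degree (legendre k) \<le> k \<and> coeff (legendre k) k > 0"
proof (induction k rule: legendre.induct)
  case (3 k)
  have d: "degree (legendre (Suc (Suc k))) \<le> Suc (Suc k)"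
    using 3 by (auto intro!: degree_diff_le order.trans[OF degree_smult_le] order.trans[OF degree_pCons_le])
  have "coeff (legendre k) (Suc (Suc k)) = 0"
    using 3 by (intro coeff_eq_0) auto
  then have "coeff (legendre (Suc (Suc k))) (Suc (Suc k)) =
      (2 * real k + 3) * coeff (legendre (Suc k)) (Suc k) / (real k + 2)"
    by simp
  with d 3 show ?case by (simp del: legendre.simps)
qed auto

text \<open>Legendre's differential equation. The two derivative identities reduce (1 - x^2) P_k' to
  k (P_{k-1} - x P_k); differentiating this and using the second identity once more leaves a
  multiple of P_k.\<close>

lemma legendre_ode:
  "pderiv ([:1, 0, -1:] * pderiv (legendre k)) = Polynomial.smult (- (real k * (real k + 1))) (legendre k)"
proof (cases k)
  case 0
  then show ?thesis by simp
next
  case (Suc j)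
  have "[:1, 0, -1:] * pderiv (legendre k) =
      Polynomial.smult (real k) (legendre j - [:0, 1:] * legendre k)"
  proof (rule poly_ext)
    fix x
    have s: "poly (pderiv (legendre k)) x =
       x * poly (pderiv (legendre j)) x + (real j + 1) * poly (legendre j) x"
      "x * poly (pderiv (legendre k)) x =
       poly (pderiv (legendre j)) x + (real j + 1) * poly (legendre k) x"
      using legendre_deriv_step[of j x] Suc by auto
    have "(1 - x * x) * poly (pderiv (legendre k)) x =
        poly (pderiv (legendre k)) x - x * (x * poly (pderiv (legendre k)) x)"
      by (simp add: algebra_simps)
    also have "\<dots> = (real j + 1) * (poly (legendre j) x - x * poly (legendre k) x)"
      unfolding s(2) unfolding s(1) by (simp add: algebra_simps)
    finally show "poly ([:1, 0, -1:] * pderiv (legendre k)) x =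
        poly (Polynomial.smult (real k) (legendre j - [:0, 1:] * legendre k)) x"
      using Suc by (simp add: algebra_simps del: legendre.simps)
  qed
  also have "pderiv \<dots> = Polynomial.smult (- (real k * (real k + 1))) (legendre k)"
  proof (rule poly_ext)
    fix x
    have s: "poly (pderiv (legendre j)) x =
       x * poly (pderiv (legendre k)) x - real k * poly (legendre k) x"
      using legendre_deriv_step[of j x] Suc by auto
    show "poly (pderiv (Polynomial.smult (real k) (legendre j - [:0, 1:] * legendre k))) x =
      poly (Polynomial.smult (- (real k * (real k + 1))) (legendre k)) x"
      by (simp add: pderiv_smult pderiv_diff pderiv_mult pderiv_pCons s del: legendre.simps)
         (simp add: algebra_simps)
  qed
  finally show ?thesis .
qed

section \<open>Integration of polynomials over an interval\<close>

text \<open>With a polynomial rather than a function as argument, integration is a linear functional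
  without integrability side conditions, and products and derivatives are those of
  polynomials.\<close>

definition pint :: "real \<Rightarrow> real \<Rightarrow> real poly \<Rightarrow> real" where
  "pint c d q = integral {c..d} (poly q)"

lemma has_integral_pint: "(poly q has_integral pint c d q) {c..d}"
  unfolding pint_def
  by (intro integrable_integral integrable_continuous_interval continuous_intros)

lemma pint_add: "pint c d (q + r) = pint c d q + pint c d r"
  using has_integral_add[OF has_integral_pint[of q c d] has_integral_pint[of r c d]]
  by (intro has_integral_unique[OF has_integral_pint]) (simp add: poly_add[abs_def])

lemma pint_smult: "pint c d (Polynomial.smult t q) = t * pint c d q"
  using has_integral_mult_right[OF has_integral_pint[of q c d], of t]
  by (intro has_integral_unique[OF has_integral_pint]) (simp add: poly_smult[abs_def])

lemma pint_0 [simp]: "pint c d 0 = 0"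
  using pint_smult[of c d 0 0] by simp

lemma pint_minus: "pint c d (- q) = - pint c d q"
  using pint_smult[of c d "-1" q] by simp

lemma pint_diff: "pint c d (q - r) = pint c d q - pint c d r"
  using pint_add[of c d q "- r"] by (simp add: pint_minus)

lemma pint_sum: "pint c d (sum f A) = (\<Sum>i\<in>A. pint c d (f i))"
  by (induction A rule: infinite_finite_induct) (auto simp: pint_add)

lemmas pint_linear = pint_add pint_diff pint_minus pint_smult

lemma pint_square_nonneg: "pint c d (q * q) \<ge> 0"
  unfolding pint_def by (rule integral_nonneg) (use has_integral_pint has_integral_integrable in \<open>blast, auto\<close>)

text \<open>A continuous nonnegative function with integral 0 vanishes on the interval, and a
  polynomial with infinitely many roots is 0.\<close>

lemma pint_square_eq_0:
  assumes "c < d" "pint c d (q * q) = 0"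
  shows "q = 0"
proof -
  have *: "((poly (q * q)) has_integral 0) (cbox c d)"
    using has_integral_pint[of "q * q" c d] assms by simp
  have "poly (q * q) x = 0" if "x \<in> {c..d}" for x
    by (rule has_integral_0_cbox_imp_0[OF _ _ *]) (use that assms(1) in \<open>auto intro!: continuous_intros\<close>)
  then have "{c..d} \<subseteq> {x. poly q x = 0}" by auto
  moreover have "infinite {c..d}" using assms by (simp add: infinite_Icc)
  ultimately show "q = 0" using poly_roots_finite finite_subset by blast
qed

lemma pint_pderiv:
  assumes "c \<le> d"
  shows "pint c d (pderiv q) = poly q d - poly q c"
  using assms
  by (intro has_integral_unique[OF has_integral_pint] fundamental_theorem_of_calculus)
     (auto simp: has_real_derivative_iff_has_vector_derivative[symmetric] intro!: poly_DERIV[THEN has_field_derivative_at_within])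

lemma pint_parts:
  assumes "c \<le> d"
  shows "pint c d (q * pderiv r) = poly (q * r) d - poly (q * r) c - pint c d (pderiv q * r)"
  using pint_pderiv[OF assms, of "q * r"] by (simp add: pderiv_mult pint_add algebra_simps)

section \<open>Orthogonality and norms of the Legendre polynomials\<close>

text \<open>Legendre's equation is tested with q and integrated by parts. There is no boundary term
  because 1 - x^2 vanishes at both endpoints.\<close>

lemma pint_legendre_ode:
  "real k * (real k + 1) * pint (-1) 1 (q * legendre k) =
     pint (-1) 1 ([:1, 0, -1:] * pderiv q * pderiv (legendre k))"
proof -
  have "- (real k * (real k + 1)) * pint (-1) 1 (q * legendre k) =
      pint (-1) 1 (q * pderiv ([:1, 0, -1:] * pderiv (legendre k)))"
    by (simp add: legendre_ode pint_linear del: mult_pCons_left mult_pCons_right)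
  also have "\<dots> = - pint (-1) 1 (pderiv q * ([:1, 0, -1:] * pderiv (legendre k)))"
    by (subst pint_parts) (simp_all del: mult_pCons_left mult_pCons_right)
  finally show ?thesis by (simp add: mult_ac del: mult_pCons_left mult_pCons_right)
qed

text \<open>Eigenfunctions of a symmetric operator: the right-hand side of
  \<open>pint_legendre_ode\<close> does not change when the two Legendre polynomials are exchanged,
  while the eigenvalues k (k + 1) and m (m + 1) differ.\<close>

lemma legendre_orthogonal:
  assumes "k \<noteq> m"
  shows "pint (-1) 1 (legendre m * legendre k) = 0"
proof -
  have "real k * (real k + 1) * pint (-1) 1 (legendre m * legendre k) =
        real m * (real m + 1) * pint (-1) 1 (legendre m * legendre k)"
    using pint_legendre_ode[of k "legendre m"] pint_legendre_ode[of m "legendre k"]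
    by (simp only: mult_ac)
  moreover have "real k * (real k + 1) \<noteq> real m * (real m + 1)"
  proof -
    have "real k * (real k + 1) - real m * (real m + 1) = (real k - real m) * (real k + real m + 1)"
      by (simp add: algebra_simps)
    then show ?thesis using assms by (auto simp: add_eq_0_iff)
  qed
  ultimately show ?thesis by simp
qed

lemma legendre_decomposition:
  assumes "degree q \<le> Suc n"
  obtains r t where "degree r \<le> n" "q = r + Polynomial.smult t (legendre (Suc n))"
proof -
  \<comment> \<open>This multiple of \<open>legendre (Suc n)\<close> has the same coefficient at
    degree \<open>Suc n\<close> as q, so the remainder drops in degree.\<close>
  define t where "t = coeff q (Suc n) / coeff (legendre (Suc n)) (Suc n)"
  define r where "r = q - Polynomial.smult t (legendre (Suc n))"
  have "coeff r i = 0" if "i > n" for i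
  proof (cases "i = Suc n")
    case True
    then show ?thesis using degree_coeff_legendre[of "Suc n"] by (simp add: r_def t_def)
  next
    case False
    then have "degree q < i" "degree (legendre (Suc n)) < i"
      using that assms degree_coeff_legendre[of "Suc n"] by auto
    then show ?thesis by (simp add: r_def coeff_eq_0)
  qed
  then have "degree r \<le> n" by (intro degree_le) auto
  moreover have "q = r + Polynomial.smult t (legendre (Suc n))"
    unfolding r_def by (simp only: diff_add_cancel)
  ultimately show ?thesis by (rule that)
qed

lemma legendre_orthogonal_lower:
  assumes "degree q \<le> n" "n < k"
  shows "pint (-1) 1 (q * legendre k) = 0"
  using assms
proof (induction n arbitrary: q)
  case 0
  then obtain t where "q = [:t:]" by (auto elim: degree_eq_zeroE)
  then show ?case using legendre_orthogonal[of k 0] 0 by (simp add: pint_linear)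
next
  case (Suc n)
  obtain r t where r: "degree r \<le> n" "q = r + Polynomial.smult t (legendre (Suc n))"
    using legendre_decomposition[OF Suc.prems(1)] by blast
  show ?case
    using Suc.IH[OF r(1)] Suc.prems legendre_orthogonal[of k "Suc n"]
    by (simp add: r(2) ring_distribs pint_linear del: legendre.simps)
qed

lemma degree_pderiv_legendre: "degree (pderiv (legendre k)) \<le> k - 1"
  using degree_coeff_legendre[of k] by (simp add: degree_pderiv diff_le_mono)

text \<open>The integral of x P_k P_k' is computed twice. As x P_k' equals k P_k up to lower degree,
  orthogonality gives k times the squared norm; integration by parts gives 2 minus the squared norm
  minus the same integral.\<close>

lemma legendre_norm: "(2 * real k + 1) * pint (-1) 1 (legendre k * legendre k) = 2"
proof -
  let ?P = "legendre k"
  have "pint (-1) 1 ([:0, 1:] * ?P * pderiv ?P) =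
      real k * pint (-1) 1 (?P * ?P)"
  proof (cases k)
    case (Suc j)
    have "[:0, 1:] * pderiv (legendre k) = pderiv (legendre j) + Polynomial.smult (real k) (legendre k)"
      proof (rule poly_ext)
      fix x
      show "poly ([:0, 1:] * pderiv (legendre k)) x =
          poly (pderiv (legendre j) + Polynomial.smult (real k) (legendre k)) x"
        using legendre_deriv_step[of j x] Suc by (auto simp del: legendre.simps)
    qed
    then have "([:0, 1:] * pderiv ?P) * ?P = pderiv (legendre j) * ?P + Polynomial.smult (real k) (?P * ?P)"
      by (simp only: distrib_right mult_smult_left)
    then have "[:0, 1:] * ?P * pderiv ?P = pderiv (legendre j) * ?P + Polynomial.smult (real k) (?P * ?P)"
      by (simp only: mult_ac)
    moreover have "pint (-1) 1 (pderiv (legendre j) * ?P) = 0"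
      using degree_pderiv_legendre[of j] Suc by (intro legendre_orthogonal_lower[of _ "j - 1"]) auto
    ultimately show ?thesis by (simp add: pint_linear)
  qed simp
  moreover have "pint (-1) 1 ([:0, 1:] * ?P * pderiv ?P) =
      2 - pint (-1) 1 (pderiv ([:0, 1:] * ?P) * ?P)"
    by (subst pint_parts) (simp_all add: legendre_at_1 legendre_at_minus_1 flip: power_add mult_2)
  moreover have "pderiv ([:0, 1:] * ?P) * ?P = ?P * ?P + [:0, 1:] * ?P * pderiv ?P"
    by (simp only: pderiv_mult) (simp add: pderiv_pCons algebra_simps)
  ultimately show ?thesis by (simp add: pint_linear algebra_simps)
qed

text \<open>After integration by parts only boundary terms remain, since P_k'' has lower degree than
  P_k and is orthogonal to it. The values of P_k' at the endpoints are read off Legendre's equation,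
  where the factor 1 - x^2 removes the second derivative.\<close>

lemma pderiv_legendre_norm:
  "pint (-1) 1 (pderiv (legendre k) * pderiv (legendre k)) = real k * (real k + 1)"
proof -
  let ?P = "legendre k"
  have ode: "poly (pderiv ([:1, 0, -1:] * pderiv ?P)) x = - (real k * (real k + 1)) * poly ?P x" for x
    by (simp only: legendre_ode poly_smult)
  have e: "pderiv [:1, 0, -1:] = [:0, -2 :: real:]" by (simp add: pderiv_pCons)
  have 1: "2 * poly (pderiv ?P) 1 = real k * (real k + 1)"
    using ode[of 1] by (simp only: pderiv_mult e) (simp add: legendre_at_1)
  have 2: "2 * poly (pderiv ?P) (-1) = - (real k * (real k + 1)) * (-1) ^ k"
    using ode[of "-1"] by (simp only: pderiv_mult e) (simp add: legendre_at_minus_1)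
  have "pint (-1) 1 (pderiv (pderiv ?P) * ?P) = 0"
    if "k > 0" using that degree_pderiv_legendre[of k]
    by (intro legendre_orthogonal_lower[of _ "k - 1"]) (auto simp: degree_pderiv)
  then have "pint (-1) 1 (pderiv (pderiv ?P) * ?P) = 0" by (cases "k = 0") auto
  then have "pint (-1) 1 (pderiv ?P * pderiv ?P) = poly (pderiv ?P * ?P) 1 - poly (pderiv ?P * ?P) (-1)"
    by (subst pint_parts) simp_all
  also have "\<dots> = (2 * poly (pderiv ?P) 1 - 2 * poly (pderiv ?P) (-1) * (-1) ^ k) / 2"
    by (simp add: legendre_at_1 legendre_at_minus_1)
  also have "\<dots> = real k * (real k + 1)"
    unfolding 1 2 by (simp flip: power_add mult_2)
  finally show ?thesis .
qed

text \<open>Since \<open>\<parallel>P\<^sub>k'\<parallel>\<^sup>2 = k (k + 1) (2 k + 1) / 2 * \<parallel>P\<^sub>k\<parallel>\<^sup>2\<close>, the constant is the sum of these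
  factors over \<open>k \<le> n\<close>.\<close>

lemma inverse_inequality_sharp:
  assumes "degree q \<le> n"
  shows "pint (-1) 1 (pderiv q * pderiv q) \<le>
     real n * (real n + 1)\<^sup>2 * (real n + 2) / 4 * pint (-1) 1 (q * q)"
  using assms
proof (induction n arbitrary: q)
  case 0
  then obtain t where "q = [:t:]" by (auto elim: degree_eq_zeroE)
  then show ?case by (simp add: pderiv_pCons)
next
  case (Suc n)
  obtain r t where r: "degree r \<le> n" and q: "q = r + Polynomial.smult t (legendre (Suc n))"
    using legendre_decomposition[OF Suc.prems] by blast
  define P where "P = Polynomial.smult t (legendre (Suc n))"
  define S where "S = real n * (real n + 1)\<^sup>2 * (real n + 2) / 4"
  \<comment> \<open>The ratio of the squared norms of P_k' and P_k for k = n + 1.\<close>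
  define s where "s = (real n + 1) * (real n + 2) * (2 * real n + 3) / 2"
  have "s > 0" "S \<ge> 0" by (auto simp: s_def S_def)
  have ih: "pint (-1) 1 (pderiv r * pderiv r) \<le> S * pint (-1) 1 (r * r)"
    unfolding S_def by (rule Suc.IH[OF r])
  have "(2 * real n + 3) * pint (-1) 1 (legendre (Suc n) * legendre (Suc n)) = 2"
    using legendre_norm[of "Suc n"] by (simp add: algebra_simps del: legendre.simps)
  then have n: "s * pint (-1) 1 (legendre (Suc n) * legendre (Suc n)) = (real n + 1) * (real n + 2)"
    unfolding s_def by (simp add: mult.assoc)
  have "pint (-1) 1 (pderiv P * pderiv P) = t * t * ((real n + 1) * (real n + 2))"
    using pderiv_legendre_norm[of "Suc n"]
    by (simp add: P_def pderiv_smult pint_linear algebra_simps del: legendre.simps)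
  also have "\<dots> = s * pint (-1) 1 (P * P)"
    unfolding n[symmetric] by (simp add: P_def pint_linear)
  finally have PP: "pint (-1) 1 (pderiv P * pderiv P) = s * pint (-1) 1 (P * P)" .
  have "pint (-1) 1 (r * P) = 0"
    using legendre_orthogonal_lower[OF r, of "Suc n"] by (simp add: P_def pint_linear del: legendre.simps)
  then have qq: "pint (-1) 1 (q * q) = pint (-1) 1 (r * r) + pint (-1) 1 (P * P)"
    by (simp only: q P_def[symmetric] ring_distribs pint_linear mult.commute[of P r])
  \<comment> \<open>The parts r and P are orthogonal, but their derivatives need not be; the cross
    term \<open>D r P\<close> has to be estimated.\<close>
  define D where "D u v = pint (-1) 1 (pderiv u * pderiv v)" for u v
  have D': "D q q = D r r + 2 * D r P + D P P"
    by (simp only: D_def q P_def[symmetric] pderiv_add ring_distribs pint_linear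
        mult.commute[of "pderiv P" "pderiv r"])
  have "D q q \<le> (S + s) * pint (-1) 1 (q * q)"
  \<comment> \<open>For n = 0 the weight S vanishes and the final cancellation of
    \<open>s * S\<close> fails, but then r is constant and there is no cross term.\<close>
  proof (cases "S = 0")
    case True
    then have "n = 0" by (auto simp: S_def)
    then have "pderiv r = 0" using r by (simp add: pderiv_eq_0_iff)
    then have "D q q = s * pint (-1) 1 (P * P)"
      using D' PP by (simp add: D_def)
    then show ?thesis
      using True \<open>s > 0\<close> pint_square_nonneg[of "-1" 1 r] by (simp add: qq)
  next
    case False
    then have "S > 0" using \<open>S \<ge> 0\<close> by simp
    \<comment> \<open>Young's inequality for the cross term. With the weights s and S, both squares
      end up with the same factor \<open>S + s\<close> in front of the squared norms of r and
      P.\<close>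
    let ?e = "Polynomial.smult s (pderiv r) - Polynomial.smult S (pderiv P)"
    have "0 \<le> pint (-1) 1 (?e * ?e)" by (rule pint_square_nonneg)
    also have "\<dots> = s * s * D r r - 2 * s * S * D r P + S * S * D P P"
      by (simp add: D_def left_diff_distrib right_diff_distrib pint_linear mult.commute[of "pderiv P" "pderiv r"])
    finally have "2 * s * S * D r P \<le> s * s * D r r + S * S * D P P" by simp
    then have "s * S * D q q \<le> s * S * D r r + (s * s * D r r + S * S * D P P) + s * S * D P P"
      unfolding D' by (simp add: algebra_simps)
    also have "\<dots> = (S + s) * (s * D r r + S * D P P)" by (simp add: algebra_simps)
    also have "\<dots> \<le> (S + s) * (s * (S * pint (-1) 1 (r * r)) + S * (s * pint (-1) 1 (P * P)))"
      using ih PP \<open>S > 0\<close> \<open>s > 0\<close> by (auto simp: D_def intro!: mult_left_mono)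
    also have "\<dots> = s * S * ((S + s) * pint (-1) 1 (q * q))" by (simp add: qq algebra_simps)
    finally show ?thesis using \<open>S > 0\<close> \<open>s > 0\<close> by simp
  qed
  \<comment> \<open>The constants are the partial sums of the factors s, here in closed
    form.\<close>
  also have "S + s = real (Suc n) * (real (Suc n) + 1)\<^sup>2 * (real (Suc n) + 2) / 4"
    by (simp add: S_def s_def field_simps power2_eq_square)
  finally show ?case by (simp add: D_def)
qed

text \<open>For p >= 1 the bounds p + 1 <= 2p and p + 2 <= 3p turn the constant p (p + 1)^2 (p +
  2)/4 into 3 p^4.\<close>

lemma inverse_inequality_unit:
  assumes "degree q \<le> p" "p \<ge> 1"
  shows "pint (-1) 1 (pderiv q * pderiv q) \<le> 3 * real p ^ 4 * pint (-1) 1 (q * q)"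
proof -
  have p: "real p \<ge> 1" using assms by simp
  have "real p * (real p + 1)\<^sup>2 * (real p + 2) \<le> real p * (2 * real p)\<^sup>2 * (3 * real p)"
    using p by (intro mult_mono power_mono) auto
  then have "real p * (real p + 1)\<^sup>2 * (real p + 2) / 4 \<le> 3 * real p ^ 4"
    by (simp add: power2_eq_square power4_eq_xxxx)
  then show ?thesis
    using inverse_inequality_sharp[OF assms(1)] pint_square_nonneg[of "-1" 1 q]
    by (meson mult_right_mono order.trans)
qed

lemma pint_affine:
  assumes "s > 0"
  shows "pint (u - s) (u + s) q = s * pint (-1) 1 (pcompose q [:u, s:])"
proof -
  have "((\<lambda>x. poly q (s * x + u)) has_integral (inverse s * pint (u - s) (u + s) q))
      ((\<lambda>x. (1 / s) * x + - ((1 / s) * u)) ` {u - s..u + s})"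
    using has_integral_affinity[of "poly q" "pint (u - s) (u + s) q" "u - s" "u + s" s u]
      has_integral_pint[of q "u - s" "u + s"] assms by (simp add: divide_inverse mult.commute)
  moreover have "(\<lambda>x. (1 / s) * x + - ((1 / s) * u)) ` {u - s..u + s} = {-1..1}"
    using assms by (simp only: image_affinity_atLeastAtMost) (simp add: field_simps)
  moreover have "(\<lambda>x. poly q (s * x + u)) = poly (pcompose q [:u, s:])"
    by (simp add: fun_eq_iff poly_pcompose algebra_simps)
  ultimately have "pint (-1) 1 (pcompose q [:u, s:]) = inverse s * pint (u - s) (u + s) q"
    using has_integral_pint has_integral_unique by metis
  then show ?thesis using assms by (simp add: field_simps)
qed

text \<open>Scaling to [-1, 1] with half-length s: the two derivatives contribute s^2, and (d - c)^2
  = 4 s^2 turns the constant 3 into 12.\<close>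

lemma inverse_inequality:
  assumes "degree q \<le> p" "p \<ge> 1" "c < d"
  shows "(d - c)\<^sup>2 * pint c d (pderiv q * pderiv q) \<le> 12 * real p ^ 4 * pint c d (q * q)"
proof -
  define s where "s = (d - c) / 2"
  define T where "T = [:(c + d) / 2, s:]"
  have "s > 0" using assms by (simp add: s_def)
  have "degree (pcompose q T) \<le> p"
    using assms \<open>s > 0\<close> by (simp add: degree_pcompose T_def)
  from inverse_inequality_unit[OF this assms(2)]
  have "pint (-1) 1 (pderiv (pcompose q T) * pderiv (pcompose q T)) \<le>
      3 * real p ^ 4 * pint (-1) 1 (pcompose q T * pcompose q T)" .
  moreover have "pderiv (pcompose q T) = Polynomial.smult s (pcompose (pderiv q) T)"
    by (simp add: pderiv_pcompose T_def pderiv_pCons)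
  ultimately have *: "s * s * pint (-1) 1 (pcompose (pderiv q * pderiv q) T) \<le>
      3 * real p ^ 4 * pint (-1) 1 (pcompose (q * q) T)"
    by (simp add: pint_linear pcompose_mult mult.assoc)
  have a: "pint c d u = s * pint (-1) 1 (pcompose u T)" for u
    using pint_affine[OF \<open>s > 0\<close>, of "(c + d) / 2" u] by (simp add: s_def T_def field_simps)
  have "(d - c)\<^sup>2 = 4 * (s * s)" by (simp add: s_def power2_eq_square)
  then show ?thesis unfolding a
    using mult_left_mono[OF *, of "4 * s"] \<open>s > 0\<close> by (simp add: algebra_simps)
qed

section \<open>The Poincare inequality for continuous piecewise polynomials\<close>

text \<open>The order of the end nodes is part of the conclusion because joining the integrals over
  two adjacent intervals requires it in the induction.\<close>

lemma has_integral_partition: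
  fixes f :: "real \<Rightarrow> real" and x :: "nat \<Rightarrow> real"
  assumes "\<And>j. j \<in> {1..n} \<Longrightarrow> x (j - 1) \<le> x j"
    and "\<And>j. j \<in> {1..n} \<Longrightarrow> (f has_integral I j) {x (j - 1)..x j}"
  shows "x 0 \<le> x n \<and> (f has_integral (\<Sum>j=1..n. I j)) {x 0..x n}"
  using assms
proof (induction n)
  case 0
  then show ?case by (simp add: has_integral_refl)
next
  case (Suc n)
  have "x 0 \<le> x n" "(f has_integral (\<Sum>j=1..n. I j)) {x 0..x n}"
    using Suc by auto
  moreover have "x n \<le> x (Suc n)" "(f has_integral I (Suc n)) {x n..x (Suc n)}"
    using Suc.prems(1)[of "Suc n"] Suc.prems(2)[of "Suc n"] by auto
  ultimately show ?case by (auto intro: has_integral_combine)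
qed

text \<open>\<open>w = - k tan (k (x - m))\<close> solves the Riccati equation \<open>w' = - k\<^sup>2 - w\<^sup>2\<close>, whence
  \<open>q'\<^sup>2 - k\<^sup>2 q\<^sup>2 = (q' - q w)\<^sup>2 + (q\<^sup>2 w)'\<close>.\<close>

lemma poincare_cell:
  assumes "c < d" "\<And>x. x \<in> {c..d} \<Longrightarrow> cos (k * (x - m)) \<noteq> 0"
  shows "k\<^sup>2 * pint c d (q * q) + k * (tan (k * (c - m)) * (poly q c)\<^sup>2 - tan (k * (d - m)) * (poly q d)\<^sup>2)
      \<le> pint c d (pderiv q * pderiv q)"
proof -
  define T where "T x = tan (k * (x - m))" for x
  define g where "g x = - k * (T x * (poly q x)\<^sup>2)" for x
  define g' where "g' x = - k * (k * (1 + (T x)\<^sup>2) * (poly q x)\<^sup>2 + 2 * T x * poly q x * poly (pderiv q) x)" for x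
  have "(g has_real_derivative g' x) (at x within {c..d})" if "x \<in> {c..d}" for x
    unfolding g_def g'_def T_def using assms(2)[OF that]
    by (auto intro!: derivative_eq_intros simp: tan_def field_simps power2_eq_square)
       (simp flip: power2_eq_square add: cos_squared_eq algebra_simps)
  then have "(g' has_integral (g d - g c)) {c..d}"
    using assms(1)
    by (intro fundamental_theorem_of_calculus) (auto simp: has_real_derivative_iff_has_vector_derivative)
  moreover have "((\<lambda>x. poly (pderiv q * pderiv q - Polynomial.smult (k\<^sup>2) (q * q)) x) has_integral
      pint c d (pderiv q * pderiv q - Polynomial.smult (k\<^sup>2) (q * q))) {c..d}"
    by (rule has_integral_pint)
  moreover have "g' x \<le> poly (pderiv q * pderiv q - Polynomial.smult (k\<^sup>2) (q * q)) x" for x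
  proof -
    \<comment> \<open>This is the square (q' - q w)^2 in the Riccati identity; dropping it gives the
      inequality.\<close>
    have "0 \<le> (poly (pderiv q) x + k * T x * poly q x)\<^sup>2" by simp
    then show ?thesis unfolding g'_def by (simp add: power2_eq_square algebra_simps)
  qed
  ultimately have "g d - g c \<le> pint c d (pderiv q * pderiv q - Polynomial.smult (k\<^sup>2) (q * q))"
    by (rule has_integral_le)
  then show ?thesis by (simp add: pint_linear g_def T_def algebra_simps)
qed

text \<open>The boundary terms of the cell inequalities telescope by continuity at the interior
  nodes and vanish at the two ends. With m the midpoint, the strict bound on k keeps k (y - m)
  inside (-pi/2, pi/2), so the tangent has no pole on the whole interval.\<close>

lemma poincare_below:
  fixes x :: "nat \<Rightarrow> real"
  assumes "\<And>j. j \<in> {1..n} \<Longrightarrow> x (j - 1) < x j"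
    and "\<And>j. j \<in> {1..<n} \<Longrightarrow> poly (q j) (x j) = poly (q (Suc j)) (x j)"
    and "n \<ge> 1" "poly (q 1) (x 0) = 0" "poly (q n) (x n) = 0"
    and "0 \<le> k" "k * (x n - x 0) < pi"
  shows "k\<^sup>2 * (\<Sum>j=1..n. pint (x (j - 1)) (x j) (q j * q j))
    \<le> (\<Sum>j=1..n. pint (x (j - 1)) (x j) (pderiv (q j) * pderiv (q j)))"
proof -
  define m where "m = (x 0 + x n) / 2"
  \<comment> \<open>Node j is evaluated with the polynomial of the cell on its left; node 0 has
    none, hence \<open>max 1 j\<close>.\<close>
  define t where "t j = k * tan (k * (x j - m)) * (poly (q (max 1 j)) (x j))\<^sup>2" for j
  have mono: "x i \<le> x j" if "i \<le> j" "j \<le> n" for i j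
    using that
  proof (induction j rule: dec_induct)
    case (step j)
    then show ?case using assms(1)[of "Suc j"] by auto
  qed auto
  have cos: "cos (k * (y - m)) \<noteq> 0" if "x 0 \<le> y" "y \<le> x n" for y
  proof -
    have "\<bar>y - m\<bar> \<le> (x n - x 0) / 2" using that by (auto simp: m_def abs_le_iff field_simps)
    then have "k * \<bar>y - m\<bar> \<le> k * ((x n - x 0) / 2)" using assms(6) by (rule mult_left_mono)
    then have "\<bar>k * (y - m)\<bar> < pi / 2" using assms(6,7) by (simp add: abs_mult)
    then have "cos (k * (y - m)) > 0" by (intro cos_gt_zero_pi) auto
    then show ?thesis by simp
  qed
  have cell: "k\<^sup>2 * pint (x (j - 1)) (x j) (q j * q j) + (t (j - 1) - t j)
      \<le> pint (x (j - 1)) (x j) (pderiv (q j) * pderiv (q j))" if j: "j \<in> {1..n}" for j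
  proof -
    have "k\<^sup>2 * pint (x (j - 1)) (x j) (q j * q j)
      + k * (tan (k * (x (j - 1) - m)) * (poly (q j) (x (j - 1)))\<^sup>2 - tan (k * (x j - m)) * (poly (q j) (x j))\<^sup>2)
      \<le> pint (x (j - 1)) (x j) (pderiv (q j) * pderiv (q j))"
      using j assms(1)[OF j] mono[of 0 "j - 1"] mono[of j n]
      by (intro poincare_cell cos) (simp_all, linarith+)
    moreover have "poly (q (max 1 (j - 1))) (x (j - 1)) = poly (q j) (x (j - 1))"
      using assms(2)[of "j - 1"] j by (cases "j = 1") (auto simp: max_def)
    moreover have "max 1 j = j" using j by auto
    ultimately show ?thesis unfolding t_def by (simp add: algebra_simps)
  qed
  have tele: "(\<Sum>j=1..n. t (j - 1) - t j) = t 0 - t n"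
    by (induction n) auto
  have "t 0 = 0" "t n = 0" using assms by (auto simp: t_def max_def)
  have "k\<^sup>2 * (\<Sum>j=1..n. pint (x (j - 1)) (x j) (q j * q j)) =
      (\<Sum>j=1..n. k\<^sup>2 * pint (x (j - 1)) (x j) (q j * q j) + (t (j - 1) - t j))"
    unfolding sum.distrib tele using \<open>t 0 = 0\<close> \<open>t n = 0\<close> by (simp add: sum_distrib_left)
  also have "\<dots> \<le> (\<Sum>j=1..n. pint (x (j - 1)) (x j) (pderiv (q j) * pderiv (q j)))"
    by (intro sum_mono cell)
  finally show ?thesis .
qed

text \<open>At the optimal K = pi / (x n - x 0) the tangent has poles at the endpoints, so the
  inequality is obtained as the limit of those for k < K.\<close>

lemma poincare:
  fixes x :: "nat \<Rightarrow> real"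
  assumes "\<And>j. j \<in> {1..n} \<Longrightarrow> x (j - 1) < x j"
    and "\<And>j. j \<in> {1..<n} \<Longrightarrow> poly (q j) (x j) = poly (q (Suc j)) (x j)"
    and "n \<ge> 1" "poly (q 1) (x 0) = 0" "poly (q n) (x n) = 0" "x 0 < x n"
  shows "(\<Sum>j=1..n. pint (x (j - 1)) (x j) (q j * q j))
    \<le> (x n - x 0)\<^sup>2 / pi\<^sup>2 * (\<Sum>j=1..n. pint (x (j - 1)) (x j) (pderiv (q j) * pderiv (q j)))"
    (is "?M \<le> _ * ?D")
proof -
  define K where "K = pi / (x n - x 0)"
  have "K > 0" using assms by (simp add: K_def)
  have "((\<lambda>k. k\<^sup>2 * ?M) \<longlongrightarrow> K\<^sup>2 * ?M) (at_left K)"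
    by (intro tendsto_intros)
  moreover have "\<forall>\<^sub>F k in at_left K. k\<^sup>2 * ?M \<le> ?D"
    using eventually_at_left_real[OF \<open>K > 0\<close>]
  proof eventually_elim
    case (elim k)
    then have "k * (x n - x 0) < pi"
      using assms(6) by (simp add: K_def pos_less_divide_eq)
    then show ?case using elim by (intro poincare_below assms) auto
  qed
  ultimately have "K\<^sup>2 * ?M \<le> ?D"
    by (intro tendsto_upperbound) auto
  then show ?thesis using assms(6) by (simp add: K_def power_divide field_simps)
qed

section \<open>The hat and bubble functions\<close>

lemma subdivision_nodes:
  assumes "subdivision a b xs"
  shows "ncells xs \<ge> 1" "xs ! 0 = a" "xs ! ncells xs = b"
    and "i < j \<Longrightarrow> j \<le> ncells xs \<Longrightarrow> xs ! i < xs ! j"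
    and "i \<le> j \<Longrightarrow> j \<le> ncells xs \<Longrightarrow> xs ! i \<le> xs ! j"
proof -
  have xs: "2 \<le> length xs" "sorted_wrt (<) xs" "hd xs = a" "last xs = b"
    using assms by (auto simp: subdivision_def)
  then have "xs \<noteq> []" by auto
  show "ncells xs \<ge> 1" "xs ! 0 = a" "xs ! ncells xs = b"
    using xs \<open>xs \<noteq> []\<close> by (auto simp: ncells_def hd_conv_nth last_conv_nth)
  show *: "xs ! i < xs ! j" if "i < j" "j \<le> ncells xs" for i j
    using sorted_wrt_nth_less[OF xs(2) that(1)] that xs(1) by (auto simp: ncells_def)
  show "i \<le> j \<Longrightarrow> j \<le> ncells xs \<Longrightarrow> xs ! i \<le> xs ! j"
    using *[of i j] by (cases "i = j") auto
qed

lemma subdivision_cell: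
  assumes "subdivision a b xs" "c \<in> {1..ncells xs}"
  shows "xs ! (c - 1) < xs ! c"
  using subdivision_nodes(4)[OF assms(1), of "c - 1" c] assms(2) by auto

lemma hat_on_cell:
  assumes "subdivision a b xs" "c \<in> {1..ncells xs}" "j \<le> ncells xs" "x \<in> {xs ! (c - 1)..xs ! c}"
  shows "hat xs j x =
    (if j = c then (x - xs ! (c - 1)) / (xs ! c - xs ! (c - 1))
     else if Suc j = c then (xs ! c - x) / (xs ! c - xs ! (c - 1)) else 0)"
proof -
  note less = subdivision_nodes(4)[OF assms(1)] and le = subdivision_nodes(5)[OF assms(1)]
  have c: "1 \<le> c" "c \<le> ncells xs" "xs ! (c - 1) \<le> x" "x \<le> xs ! c" "xs ! (c - 1) < xs ! c"
    using assms subdivision_cell[OF assms(1,2)] by auto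
  consider "j = c" | "Suc j = c" | "Suc j < c" | "j > c" by linarith
  then show ?thesis
  proof cases
    case 1
    then show ?thesis using c by (simp add: hat_def)
  next
    case 2
    then have j: "j < ncells xs" "xs ! j \<le> x" "x \<le> xs ! Suc j" "c - 1 = j" using c by auto
    show ?thesis
    proof (cases "1 \<le> j \<and> x \<le> xs ! j")
      case True
      \<comment> \<open>At the node itself the first branch of \<open>hat\<close>, belonging to the
        cell on the left, is the one that applies; both branches have the value 1 there.\<close>
      then have "x = xs ! j" "xs ! (j - 1) < xs ! j" using j less[of "j - 1" j] by auto
      then show ?thesis using 2 j c True by (simp add: hat_def)
    next
      case False
      then show ?thesis using 2 j c by (auto simp: hat_def)
    qed
  next
    case 3
    then have "xs ! j < xs ! (c - 1)" "xs ! Suc j \<le> xs ! (c - 1)"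
      using less[of j "c - 1"] le[of "Suc j" "c - 1"] c by auto
    then show ?thesis using 3 c by (auto simp: hat_def)
  next
    case 4
    then have "xs ! c < xs ! j" "xs ! c \<le> xs ! (j - 1)"
      using less[of c j] le[of c "j - 1"] assms(3) by auto
    then show ?thesis using 4 c by (auto simp: hat_def)
  qed
qed

lemma hat_at_node:
  assumes "subdivision a b xs" "i \<le> ncells xs" "j \<le> ncells xs"
  shows "hat xs j (xs ! i) = (if i = j then 1 else 0)"
proof (cases "i = 0")
  case True
  then show ?thesis
    using hat_on_cell[OF assms(1), of 1 j "xs ! 0"] subdivision_nodes(1)[OF assms(1)]
      subdivision_cell[OF assms(1), of 1] assms(3) by auto
next
  case False
  then show ?thesis
    using hat_on_cell[OF assms(1), of i j "xs ! i"] subdivision_cell[OF assms(1), of i] assms(2,3)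
    by auto
qed

lemma bubble_poly_endpoints: "poly (bubble_poly k) 1 = 0" "poly (bubble_poly k) (-1) = 0"
  unfolding bubble_poly_def
  by (simp_all add: legendre_at_1 legendre_at_minus_1 del: legendre.simps)

lemma coeff_bubble_poly_gt:
  assumes "i > k + 2"
  shows "coeff (bubble_poly k) i = 0"
  using degree_coeff_legendre[of k] degree_coeff_legendre[of "k + 2"] assms
  by (auto simp: bubble_poly_def coeff_eq_0 simp del: legendre.simps)

text \<open>Only \<open>legendre (k + 2)\<close> contributes at this degree. The bubble polynomials
  therefore have distinct degrees, which makes them independent.\<close>

lemma coeff_bubble_poly_top: "coeff (bubble_poly k) (k + 2) \<noteq> 0"
  using degree_coeff_legendre[of k] degree_coeff_legendre[of "k + 2"]
  by (auto simp: bubble_poly_def coeff_eq_0 simp del: legendre.simps)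

lemma degree_bubble_poly: "degree (bubble_poly k) \<le> k + 2"
  using coeff_bubble_poly_gt by (intro degree_le) blast

text \<open>Closed cells share nodes, so a bubble of a neighbouring cell may be evaluated by its
  polynomial branch at a common node; there its argument is 1 or -1, where the polynomial
  vanishes.\<close>

lemma bubble_on_cell:
  assumes "subdivision a b xs" "c \<in> {1..ncells xs}" "j \<in> {1..ncells xs}" "x \<in> {xs ! (c - 1)..xs ! c}"
  shows "bubble xs k j x = (if j = c then poly (bubble_poly k) (cell_map xs c x) else 0)"
proof -
  note less = subdivision_nodes(4)[OF assms(1)] and le = subdivision_nodes(5)[OF assms(1)]
  have l: "xs ! (j - 1) < xs ! j" by (rule subdivision_cell[OF assms(1,3)])
  consider "j = c" | "j < c" | "j > c" by linarith
  then show ?thesis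
  proof cases
    case 1
    then show ?thesis using assms by (simp add: bubble_def)
  next
    case 2
    then have "xs ! j \<le> xs ! (c - 1)" using le[of j "c - 1"] assms(2) by auto
    then have "xs ! j \<le> x" using assms(4) by auto
    moreover have "cell_map xs j (xs ! j) = 1" using l by (simp add: cell_map_def)
    ultimately show ?thesis using 2 bubble_poly_endpoints by (auto simp: bubble_def dest: antisym)
  next
    case 3
    then have "xs ! c \<le> xs ! (j - 1)" using le[of c "j - 1"] assms(3) by auto
    then have "x \<le> xs ! (j - 1)" using assms(4) by auto
    moreover have "cell_map xs j (xs ! (j - 1)) = -1" using l by (simp add: cell_map_def field_simps)
    ultimately show ?thesis using 3 bubble_poly_endpoints by (auto simp: bubble_def dest: antisym)
  qed
qed

lemma bubble_at_node:
  assumes "subdivision a b xs" "i \<le> ncells xs" "j \<in> {1..ncells xs}"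
  shows "bubble xs k j (xs ! i) = 0"
proof -
  define c where "c = max 1 i"
  have c: "c \<in> {1..ncells xs}" "i = c \<or> i = c - 1"
    using assms(2) subdivision_nodes(1)[OF assms(1)] by (auto simp: c_def)
  have l: "xs ! (c - 1) < xs ! c" by (rule subdivision_cell[OF assms(1) c(1)])
  have "cell_map xs c (xs ! i) \<in> {-1, 1}"
    using c(2) l by (auto simp: cell_map_def field_simps)
  then show ?thesis
    using bubble_on_cell[OF assms(1) c(1) assms(3), of "xs ! i" k] c(2) l bubble_poly_endpoints by auto
qed

text \<open>Local polynomial representatives, through which all integrals and derivatives of basis
  functions are computed. Hats have degree at most 1, and bubbles at most k + 2, which is at most p
  because k < p - 1.\<close>

lemma basis_on_cell:
  assumes "subdivision a b xs" "p \<ge> 1" "f \<in> set (basis bc p xs)" "c \<in> {1..ncells xs}"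
  shows "\<exists>q. degree q \<le> p \<and> (\<forall>x\<in>{xs ! (c - 1)..xs ! c}. f x = poly q x)"
proof -
  define s where "s = 1 / (xs ! c - xs ! (c - 1))"
  have "set (basis bc p xs) \<subseteq> hat xs ` {..ncells xs} \<union> (\<Union>k<p - 1. bubble xs k ` {1..ncells xs})"
    by (cases bc) (auto simp: C_basis_def Q_basis_def bubbles_def)
  then consider j where "j \<le> ncells xs" "f = hat xs j"
    | k j where "k < p - 1" "j \<in> {1..ncells xs}" "f = bubble xs k j"
    using assms(3) by auto
  then show ?thesis
  proof cases
    case 1
    define q where "q = (if j = c then [:- xs ! (c - 1) * s, s:]
        else if Suc j = c then [:xs ! c * s, - s:] else 0)"
    have "degree q \<le> 1" by (auto simp: q_def)
    moreover have "f x = poly q x" if "x \<in> {xs ! (c - 1)..xs ! c}" for x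
      unfolding 1(2) hat_on_cell[OF assms(1,4) 1(1) that] by (simp add: q_def s_def divide_inverse algebra_simps)
    ultimately show ?thesis using assms(2) by (intro exI[of _ q]) auto
  next
    case 2
    define q where "q = (if j = c
        then pcompose (bubble_poly k) [:- (xs ! (c - 1) + xs ! c) * s, 2 * s:] else 0)"
    have "degree (pcompose (bubble_poly k) [:u, v:]) \<le> degree (bubble_poly k) * 1" for u v
      by (rule order.trans[OF degree_pcompose_le]) auto
    then have "degree q \<le> p" using degree_bubble_poly[of k] 2(1)
      by (auto simp: q_def intro: order.trans)
    moreover have "f x = poly q x" if "x \<in> {xs ! (c - 1)..xs ! c}" for x
      unfolding 2(3) bubble_on_cell[OF assms(1,4) 2(2) that]
      by (auto simp: q_def s_def cell_map_def poly_pcompose divide_inverse algebra_simps)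
    ultimately show ?thesis by blast
  qed
qed

section \<open>Linear independence of the basis functions\<close>

lemma length_concat_const:
  assumes "\<And>k. length (B k) = n"
  shows "length (concat (map B [0..<m])) = m * n"
  using assms by (induction m) auto

lemma nth_concat_const:
  assumes "\<And>k. length (B k) = n" "k < m" "j < n"
  shows "concat (map B [0..<m]) ! (k * n + j) = B k ! j"
  using assms(2)
proof (induction m)
  case (Suc m)
  note len = length_concat_const[of B n m, OF assms(1)]
  show ?case
  proof (cases "k = m")
    case True
    then show ?thesis by (simp add: nth_append len)
  next
    case False
    then have "Suc k * n \<le> m * n" using Suc.prems by (intro mult_le_mono1) auto
    then have "k * n + j < m * n" using assms(3) by simp
    then show ?thesis using Suc False by (simp add: nth_append len)
  qed
qed simp

lemma length_bubbles: "length (bubbles p xs) = (p - 1) * ncells xs"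
  unfolding bubbles_def by (rule length_concat_const) simp

lemma bubbles_nth:
  assumes "k < p - 1" "j < ncells xs"
  shows "bubbles p xs ! (k * ncells xs + j) = bubble xs k (Suc j)"
proof -
  have "bubbles p xs ! (k * ncells xs + j) = map (bubble xs k) [1..<ncells xs + 1] ! j"
    unfolding bubbles_def using assms by (intro nth_concat_const) auto
  also have "\<dots> = bubble xs k (Suc j)"
    using assms(2) by (subst nth_map) (auto simp del: upt_Suc)
  finally show ?thesis .
qed

text \<open>The coefficient at the top degree isolates the last summand; induction removes the
  others.\<close>

lemma bubble_poly_independent:
  assumes "(\<Sum>k<m. Polynomial.smult (v k) (bubble_poly k)) = 0" "k < m"
  shows "v k = 0"
  using assms
proof (induction m)
  case (Suc m)
  have "coeff (\<Sum>k<Suc m. Polynomial.smult (v k) (bubble_poly k)) (m + 2) = v m * coeff (bubble_poly m) (m + 2)"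
    by (simp add: coeff_sum coeff_bubble_poly_gt)
  then have "v m = 0" unfolding Suc.prems(1) using coeff_bubble_poly_top[of m] by simp
  then show ?case using Suc by (cases "k = m") auto
qed simp

lemma sum_lessThan_add:
  fixes f :: "nat \<Rightarrow> 'a :: comm_monoid_add"
  shows "sum f {..<m + n} = sum f {..<m} + (\<Sum>i<n. f (m + i))"
  by (induction n) (auto simp: add.assoc)

lemma sum_lessThan_mult:
  fixes f :: "nat \<Rightarrow> 'a :: comm_monoid_add"
  shows "sum f {..<m * n} = (\<Sum>k<m. \<Sum>j<n. f (k * n + j))"
proof (induction m)
  case (Suc m)
  have "sum f {..<Suc m * n} = sum f {..<m * n + n}" by (simp add: add.commute)
  with Suc show ?case by (simp only: sum_lessThan_add sum.lessThan_Suc)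
qed simp

text \<open>At the nodes all bubbles vanish and the hats form a Kronecker delta, which isolates the
  hat coefficients. On a single cell a combination of bubble polynomials then remains. The bounds l
  and m let one proof serve both bases.\<close>

lemma basis_independent:
  assumes "subdivision a b xs" "m \<le> Suc (ncells xs)" "Y = map (hat xs) [l..<m] @ bubbles p xs"
    and zero: "\<And>x. x \<in> {a..b} \<Longrightarrow> (\<Sum>i<length Y. v i * (Y ! i) x) = 0"
    and "i < length Y"
  shows "v i = 0"
proof -
  define n where "n = ncells xs"
  define H where "H = m - l"
  note nodes = subdivision_nodes[OF assms(1)]
  have len: "length Y = H + (p - 1) * n"
    by (simp add: assms(3) H_def n_def length_bubbles)
  have "(\<Sum>i<length Y. v i * (Y ! i) x) = (\<Sum>i<H. v i * hat xs (l + i) x) +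
      (\<Sum>k<p - 1. \<Sum>j<n. v (H + (k * n + j)) * bubble xs k (Suc j) x)" for x
    unfolding len sum_lessThan_add sum_lessThan_mult
    by (intro arg_cong2[where f = "(+)"] sum.cong refl)
       (simp_all add: assms(3) H_def n_def nth_append bubbles_nth)
  then have zero': "(\<Sum>i<H. v i * hat xs (l + i) x) +
      (\<Sum>k<p - 1. \<Sum>j<n. v (H + (k * n + j)) * bubble xs k (Suc j) x) = 0" if "x \<in> {a..b}" for x
    using zero[OF that] by simp
  have hats: "v i = 0" if "i < H" for i
  proof -
    have i: "l + i \<le> ncells xs" using that assms(2) by (simp add: H_def)
    have "xs ! (l + i) \<in> {a..b}" using nodes(2,3) nodes(5)[of 0 "l + i"] nodes(5)[OF i] i by auto
    moreover have "v i' * hat xs (l + i') (xs ! (l + i)) = (if i' = i then v i else 0)" if "i' < H" for i'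
      using hat_at_node[OF assms(1) i, of "l + i'"] that assms(2) by (simp add: H_def)
    then have "(\<Sum>i'<H. v i' * hat xs (l + i') (xs ! (l + i))) = (\<Sum>i'<H. if i' = i then v i else 0)"
      by (intro sum.cong) auto
    moreover have "bubble xs k (Suc j) (xs ! (l + i)) = 0" if "j < n" for k j
      using that by (intro bubble_at_node[OF assms(1) i]) (auto simp: n_def)
    ultimately show ?thesis using zero'[of "xs ! (l + i)"] that by simp
  qed
  have bubbles: "v (H + (k * n + j)) = 0" if "k < p - 1" "j < n" for k j
  proof -
    define c where "c = Suc j"
    have c: "c \<in> {1..ncells xs}" using that by (auto simp: c_def n_def)
    have l: "xs ! (c - 1) < xs ! c" by (rule subdivision_cell[OF assms(1) c])
    define w where "w = (\<Sum>k<p - 1. Polynomial.smult (v (H + (k * n + j))) (bubble_poly k))"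
    have "poly w t = 0" if t: "t \<in> {-1..1}" for t
    proof -
      \<comment> \<open>The preimage of t under the map of cell c onto [-1, 1].\<close>
      define x where "x = (xs ! (c - 1) + xs ! c) / 2 + t * ((xs ! c - xs ! (c - 1)) / 2)"
      have "\<bar>t * ((xs ! c - xs ! (c - 1)) / 2)\<bar> \<le> 1 * ((xs ! c - xs ! (c - 1)) / 2)"
        unfolding abs_mult using t l by (intro mult_mono) auto
      then have x: "x \<in> {xs ! (c - 1)..xs ! c}" by (auto simp: x_def abs_le_iff field_simps)
      then have "x \<in> {a..b}" using nodes(2,3) nodes(5)[of 0 "c - 1"] nodes(5)[of c "ncells xs"] c
        by (simp, linarith)
      moreover have "cell_map xs c x = t" using l by (simp add: x_def cell_map_def field_simps)
      then have "v (H + (k * n + j')) * bubble xs k (Suc j') x =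
          (if j' = j then v (H + (k * n + j)) * poly (bubble_poly k) t else 0)" if "j' < n" for k j'
        using bubble_on_cell[OF assms(1) c _ x, of "Suc j'" k] that by (auto simp: c_def n_def)
      then have "(\<Sum>k<p - 1. \<Sum>j'<n. v (H + (k * n + j')) * bubble xs k (Suc j') x) =
          (\<Sum>k<p - 1. \<Sum>j'<n. if j' = j then v (H + (k * n + j)) * poly (bubble_poly k) t else 0)"
        by (intro sum.cong) auto
      ultimately show ?thesis using zero'[of x] \<open>j < n\<close> hats by (simp add: w_def poly_sum)
    qed
    then have "{-1..1} \<subseteq> {t. poly w t = 0}" by auto
    moreover have "infinite {-1..1::real}" by (simp add: infinite_Icc)
    ultimately have "w = 0" using poly_roots_finite finite_subset by blast
    then show ?thesis using bubble_poly_independent \<open>k < p - 1\<close> unfolding w_def by fast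
  qed
  show ?thesis
  proof (cases "i < H")
    case False
    define i' where "i' = i - H"
    have "i' < (p - 1) * n" using False assms(5) by (simp add: i'_def len)
    moreover from this have "n > 0" by (cases n) auto
    ultimately have "i' div n < p - 1" "i' mod n < n"
      by (auto simp: less_mult_imp_div_less)
    from bubbles[OF this] False show ?thesis by (simp add: i'_def)
  qed (rule hats)
qed

section \<open>Spectral bounds from quadratic forms\<close>

lemma scalar_prod_transpose_mult:
  fixes L :: "real mat"
  assumes "L \<in> carrier_mat n n" "v \<in> carrier_vec n"
  shows "scalar_prod v ((transpose_mat L * L) *\<^sub>v v) = scalar_prod (L *\<^sub>v v) (L *\<^sub>v v)"
proof -
  have "(transpose_mat L * L) *\<^sub>v v = transpose_mat L *\<^sub>v (L *\<^sub>v v)"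
    using assms by (intro assoc_mult_mat_vec) auto
  then show ?thesis
    using assms transpose_vec_mult_scalar[of L n n v "L *\<^sub>v v"]
    by (simp add: comm_scalar_prod[of v n])
qed

lemma scalar_prod_self_pos:
  fixes v :: "real vec"
  assumes "v \<in> carrier_vec n" "v \<noteq> 0\<^sub>v n"
  shows "scalar_prod v v > 0"
proof -
  obtain i where "i < n" "v $ i \<noteq> 0"
    using assms by (auto simp: vec_eq_iff)
  then show ?thesis using assms(1)
    unfolding scalar_prod_def
    by (intro sum_pos2[of _ i]) (auto simp: zero_less_mult_iff)
qed

text \<open>For a complex eigenvector x + i y, comparing y . S x with x . S y yields Im \<mu> (x . x
  + y . y) = 0. Hence \<mu> is real, and whichever of x and y is nonzero is a real
  eigenvector.\<close>

lemma symmetric_eigenvalue_real: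
  fixes S :: "real mat"
  assumes S: "S \<in> carrier_mat n n" "transpose_mat S = S"
    and "\<mu> \<in> spectrum (map_mat complex_of_real S)"
  obtains x where "x \<in> carrier_vec n" "x \<noteq> 0\<^sub>v n" "S *\<^sub>v x = Re \<mu> \<cdot>\<^sub>v x" "\<mu> = complex_of_real (Re \<mu>)"
proof -
  obtain z where z: "z \<in> carrier_vec n" "z \<noteq> 0\<^sub>v n" "map_mat complex_of_real S *\<^sub>v z = \<mu> \<cdot>\<^sub>v z"
    using assms by (auto simp: spectrum_def eigenvalue_def eigenvector_def)
  define x where "x = map_vec Re z"
  define y where "y = map_vec Im z"
  have carrier: "x \<in> carrier_vec n" "y \<in> carrier_vec n" using z by (auto simp: x_def y_def)
  have eq: "(\<Sum>j<n. complex_of_real (S $$ (i, j)) * z $ j) = \<mu> * z $ i" if "i < n" for i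
    using arg_cong[OF z(3), of "\<lambda>w. w $ i"] that z(1) S(1)
    by (simp add: scalar_prod_def atLeast0LessThan)
  have Sx: "S *\<^sub>v x = Re \<mu> \<cdot>\<^sub>v x - Im \<mu> \<cdot>\<^sub>v y"
  proof (rule eq_vecI)
    fix i assume "i < dim_vec (Re \<mu> \<cdot>\<^sub>v x - Im \<mu> \<cdot>\<^sub>v y)"
    then have i: "i < n" using carrier by simp
    show "(S *\<^sub>v x) $ i = (Re \<mu> \<cdot>\<^sub>v x - Im \<mu> \<cdot>\<^sub>v y) $ i"
      using arg_cong[OF eq[OF i], of Re] i z(1) S(1)
      by (simp add: scalar_prod_def atLeast0LessThan x_def y_def)
  qed (use S carrier in auto)
  have Sy: "S *\<^sub>v y = Re \<mu> \<cdot>\<^sub>v y + Im \<mu> \<cdot>\<^sub>v x"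
  proof (rule eq_vecI)
    fix i assume "i < dim_vec (Re \<mu> \<cdot>\<^sub>v y + Im \<mu> \<cdot>\<^sub>v x)"
    then have i: "i < n" using carrier by simp
    show "(S *\<^sub>v y) $ i = (Re \<mu> \<cdot>\<^sub>v y + Im \<mu> \<cdot>\<^sub>v x) $ i"
      using arg_cong[OF eq[OF i], of Im] i z(1) S(1)
      by (simp add: scalar_prod_def atLeast0LessThan x_def y_def)
  qed (use S carrier in auto)
  have "scalar_prod y (S *\<^sub>v x) = scalar_prod x (S *\<^sub>v y)"
    using transpose_vec_mult_scalar[OF S(1) carrier(2,1)] S carrier
    by (simp add: comm_scalar_prod[of x n] comm_scalar_prod[of y n "S *\<^sub>v x"])
  then have *: "Im \<mu> * (scalar_prod x x + scalar_prod y y) = 0"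
    unfolding Sx Sy using carrier
    by (simp add: scalar_prod_minus_distrib[of _ n] scalar_prod_add_distrib[of _ n] comm_scalar_prod[of y n x]
        distrib_left)
  have "x \<noteq> 0\<^sub>v n \<or> y \<noteq> 0\<^sub>v n"
    using z(1,2) by (auto simp: x_def y_def vec_eq_iff complex_eq_iff)
  moreover have "scalar_prod x x \<ge> 0" "scalar_prod y y \<ge> 0" by (auto simp: scalar_prod_def intro: sum_nonneg)
  ultimately have "scalar_prod x x + scalar_prod y y > 0"
    using scalar_prod_self_pos[OF carrier(1)] scalar_prod_self_pos[OF carrier(2)] by fastforce
  with * have im: "Im \<mu> = 0" by simp
  then have "S *\<^sub>v x = Re \<mu> \<cdot>\<^sub>v x" "S *\<^sub>v y = Re \<mu> \<cdot>\<^sub>v y"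
    unfolding Sx Sy using carrier by (auto simp: vec_eq_iff)
  moreover have "\<mu> = complex_of_real (Re \<mu>)" using im by (simp add: complex_eq_iff)
  ultimately show ?thesis using that carrier \<open>x \<noteq> 0\<^sub>v n \<or> y \<noteq> 0\<^sub>v n\<close> by blast
qed

text \<open>If x is an eigenvector of the transformed matrix and y is the inverse of L applied to x,
  then the forms of M and of \<open>transpose_mat L * L\<close> at y are \<mu> x . x and x . x. Thus
  \<mu> is a Rayleigh quotient, and \<open>lower\<close> and \<open>upper\<close> enclose
  it.\<close>

lemma spectrum_generalized_bounds:
  fixes L M :: "real mat"
  assumes L: "L \<in> carrier_mat n n" and M: "M \<in> carrier_mat n n" "transpose_mat M = M"
    and pos: "\<And>v. v \<in> carrier_vec n \<Longrightarrow> v \<noteq> 0\<^sub>v n \<Longrightarrow> scalar_prod v (M *\<^sub>v v) > 0"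
    and lower: "\<And>v. v \<in> carrier_vec n \<Longrightarrow>
      lo * scalar_prod v ((transpose_mat L * L) *\<^sub>v v) \<le> scalar_prod v (M *\<^sub>v v)"
    and upper: "\<And>v. v \<in> carrier_vec n \<Longrightarrow>
      scalar_prod v (M *\<^sub>v v) \<le> hi * scalar_prod v ((transpose_mat L * L) *\<^sub>v v)"
  shows "invertible_mat L \<and>
    spectrum (map_mat complex_of_real (transpose_mat (inv_mat L) * M * inv_mat L)) \<subseteq> complex_of_real ` {lo..hi}"
proof -
  have "det L \<noteq> 0"
  proof
    assume "det L = 0"
    then obtain v where v: "v \<in> carrier_vec n" "v \<noteq> 0\<^sub>v n" "L *\<^sub>v v = 0\<^sub>v n"
      using det_0_iff_vec_prod_zero_field[OF L] by blast
    then have "scalar_prod v ((transpose_mat L * L) *\<^sub>v v) = 0"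
      unfolding scalar_prod_transpose_mult[OF L v(1)] by simp
    \<comment> \<open>A kernel vector of L would make the form of M nonpositive by the upper bound,
      against definiteness.\<close>
    with pos[OF v(1,2)] upper[OF v(1)] show False by simp
  qed
  then obtain B where "mat_inverse L = Some B"
    using det_non_zero_imp_unit[OF L, of "()"] mat_inverse(1)[OF L, of "()"] by (cases "mat_inverse L") auto
  then have inv: "inv_mat L = B" "L * B = 1\<^sub>m n" "B * L = 1\<^sub>m n" "B \<in> carrier_mat n n"
    using mat_inverse(2)[OF L] by (auto simp: inv_mat_def)
  have "invertible_mat L"
    unfolding invertible_mat_def inverts_mat_def using L inv by auto
  moreover have "\<mu> \<in> complex_of_real ` {lo..hi}"
    if \<mu>: "\<mu> \<in> spectrum (map_mat complex_of_real (transpose_mat B * M * B))" for \<mu>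
  proof -
    define S where "S = transpose_mat B * M * B"
    have S: "S \<in> carrier_mat n n" using inv M by (simp add: S_def)
    have "transpose_mat S = transpose_mat B * transpose_mat (transpose_mat B * M)"
      unfolding S_def by (rule transpose_mult[of _ n n _ n]) (use inv M in auto)
    also have "transpose_mat (transpose_mat B * M) = transpose_mat M * transpose_mat (transpose_mat B)"
      by (rule transpose_mult[of _ n n _ n]) (use inv M in auto)
    also have "transpose_mat B * \<dots> = S"
      unfolding S_def using inv M by (simp add: assoc_mult_mat[of _ n n M n B n])
    finally have "transpose_mat S = S" .
    then obtain x where x: "x \<in> carrier_vec n" "x \<noteq> 0\<^sub>v n" "S *\<^sub>v x = Re \<mu> \<cdot>\<^sub>v x" "\<mu> = complex_of_real (Re \<mu>)"
      using symmetric_eigenvalue_real[OF S _ \<mu>[folded S_def]] by blast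
    define y where "y = B *\<^sub>v x"
    have y: "y \<in> carrier_vec n" using inv x by (simp add: y_def)
    have "L *\<^sub>v y = x"
      unfolding y_def using L inv x by (simp flip: assoc_mult_mat_vec)
    then have LL: "scalar_prod y ((transpose_mat L * L) *\<^sub>v y) = scalar_prod x x"
      by (simp add: scalar_prod_transpose_mult[OF L y])
    have "S *\<^sub>v x = transpose_mat B *\<^sub>v (M *\<^sub>v y)"
      unfolding S_def y_def using inv M x
      by (simp add: assoc_mult_mat_vec[of _ n n _ n] assoc_mult_mat[of _ n n M n B n])
    then have "scalar_prod (M *\<^sub>v y) y = scalar_prod (S *\<^sub>v x) x"
      using transpose_vec_mult_scalar[OF inv(4) x(1), of "M *\<^sub>v y"] M(1) y by (simp add: y_def)
    then have MM: "scalar_prod y (M *\<^sub>v y) = Re \<mu> * scalar_prod x x"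
      unfolding x(3) using x(1) M(1) y by (simp add: comm_scalar_prod[of y n])
    have "lo * scalar_prod x x \<le> Re \<mu> * scalar_prod x x" "Re \<mu> * scalar_prod x x \<le> hi * scalar_prod x x"
      using lower[OF y] upper[OF y] unfolding LL MM by auto
    then have "Re \<mu> \<in> {lo..hi}" using scalar_prod_self_pos[OF x(1,2)] by simp
    then show ?thesis using x(4) by blast
  qed
  ultimately show ?thesis unfolding inv(1) by blast
qed

section \<open>Quadratic forms of the mass matrix and the weak Laplacian\<close>

lemma pderiv_sum_smult:
  fixes q :: "'i \<Rightarrow> real poly"
  shows "pderiv (\<Sum>i\<in>I. Polynomial.smult (v i) (q i)) = (\<Sum>i\<in>I. Polynomial.smult (v i) (pderiv (q i)))"
  by (induction I rule: infinite_finite_induct) (auto simp: pderiv_add pderiv_smult)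

lemma quadratic_form_sum:
  fixes W :: "real mat"
  assumes "W \<in> carrier_mat n n" "v \<in> carrier_vec n"
  shows "scalar_prod v (W *\<^sub>v v) = (\<Sum>i<n. \<Sum>j<n. v $ i * v $ j * W $$ (i, j))"
  using assms by (simp add: scalar_prod_def atLeast0LessThan sum_distrib_left mult_ac)

text \<open>Bilinearity turns the quadratic form of a Gram matrix into a sum of integrals of squares
  over the cells. It serves both the mass matrix and, with derivatives for r, the weak
  Laplacian.\<close>

lemma pint_gram:
  "(\<Sum>i\<in>I. \<Sum>j\<in>I. v i * v j * (\<Sum>c\<in>C. pint (l c) (u c) (r i c * r j c))) =
   (\<Sum>c\<in>C. pint (l c) (u c) ((\<Sum>i\<in>I. Polynomial.smult (v i) (r i c)) * (\<Sum>i\<in>I. Polynomial.smult (v i) (r i c))))"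
proof -
  have "(\<Sum>i\<in>I. \<Sum>j\<in>I. v i * v j * (\<Sum>c\<in>C. pint (l c) (u c) (r i c * r j c))) =
      (\<Sum>i\<in>I. \<Sum>c\<in>C. \<Sum>j\<in>I. v i * v j * pint (l c) (u c) (r i c * r j c))"
    unfolding sum_distrib_left by (intro sum.cong refl sum.swap)
  also have "\<dots> = (\<Sum>c\<in>C. \<Sum>i\<in>I. \<Sum>j\<in>I. v i * v j * pint (l c) (u c) (r i c * r j c))"
    by (rule sum.swap)
  also have "\<dots> = (\<Sum>c\<in>C. pint (l c) (u c) ((\<Sum>i\<in>I. Polynomial.smult (v i) (r i c)) * (\<Sum>i\<in>I. Polynomial.smult (v i) (r i c))))"
    unfolding sum_product pint_sum by (simp add: pint_linear mult_ac)
  finally show ?thesis .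
qed

text \<open>Agreement is asked for only inside the cells: finitely many nodes do not affect the
  integral, and \<open>deriv\<close> is uncontrolled there.\<close>

lemma integral_subdivision:
  assumes "subdivision a b xs"
    and "\<And>c x. c \<in> {1..ncells xs} \<Longrightarrow> x \<in> {xs ! (c - 1)<..<xs ! c} \<Longrightarrow> f x = poly (q c) x"
  shows "integral {a..b} f = (\<Sum>c=1..ncells xs. pint (xs ! (c - 1)) (xs ! c) (q c))"
proof -
  have "(f has_integral pint (xs ! (c - 1)) (xs ! c) (q c)) {xs ! (c - 1)..xs ! c}"
    if "c \<in> {1..ncells xs}" for c
    using has_integral_spike_interior[of "poly (q c)" _ "xs ! (c - 1)" "xs ! c" f] has_integral_pint
      assms(2)[OF that] by simp
  then have "(f has_integral (\<Sum>c=1..ncells xs. pint (xs ! (c - 1)) (xs ! c) (q c))) {xs ! 0..xs ! ncells xs}"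
    by (intro has_integral_partition[where x = "(!) xs", THEN conjunct2])
       (use subdivision_cell[OF assms(1)] in \<open>auto intro: less_imp_le\<close>)
  then show ?thesis
    using subdivision_nodes[OF assms(1)] by (auto intro: integral_unique)
qed

lemma deriv_eq_pderiv:
  fixes f :: "real \<Rightarrow> real"
  assumes "\<And>y. y \<in> {c..d} \<Longrightarrow> f y = poly q y" "x \<in> {c<..<d}"
  shows "deriv f x = poly (pderiv q) x"
proof (rule DERIV_imp_deriv)
  show "(f has_real_derivative poly (pderiv q) x) (at x)"
    by (rule has_field_derivative_transform_within_open[OF poly_DERIV, of "{c<..<d}"]) (use assms in auto)
qed

lemma Dirichlet_basis_endpoints:
  assumes "subdivision a b xs" "f \<in> set (basis Dirichlet p xs)"
  shows "f a = 0" "f b = 0"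
proof -
  have "set (basis Dirichlet p xs) \<subseteq> hat xs ` {1..<ncells xs} \<union> (\<Union>k<p - 1. bubble xs k ` {1..ncells xs})"
    by (auto simp: Q_basis_def bubbles_def)
  then consider j where "j \<in> {1..<ncells xs}" "f = hat xs j"
    | k j where "j \<in> {1..ncells xs}" "f = bubble xs k j"
    using assms(2) by blast
  then have "f (xs ! i) = 0" if "i = 0 \<or> i = ncells xs" for i
  proof cases
    case 1
    then show ?thesis using hat_at_node[OF assms(1), of i j] that by auto
  next
    case 2
    then show ?thesis using bubble_at_node[OF assms(1), of i j k] that by auto
  qed
  then show "f a = 0" "f b = 0"
    using subdivision_nodes(2,3)[OF assms(1)] by auto
qed

lemma min_length_bounds:
  assumes "subdivision a b xs"
  shows "min_length xs > 0" "c \<in> {1..ncells xs} \<Longrightarrow> min_length xs \<le> xs ! c - xs ! (c - 1)"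
proof -
  have "min_length xs \<in> cell_length xs ` {1..ncells xs}"
    unfolding min_length_def using subdivision_nodes(1)[OF assms] by (intro Min_in) auto
  then show "min_length xs > 0"
    using subdivision_cell[OF assms] by (auto simp: cell_length_def)
  show "min_length xs \<le> xs ! c - xs ! (c - 1)" if "c \<in> {1..ncells xs}"
    unfolding min_length_def using that by (intro Min_le) (auto simp: cell_length_def)
qed

text \<open>For the function u with coefficient vector v, m and d are the squared norms of u and u'.
  The inverse and Poincare inequalities, applied to the restrictions \<open>Q c\<close> of u to the
  cells, become inequalities between the two forms.\<close>

lemma basis_quadratic_forms:
  assumes sub: "subdivision a b xs" and "p \<ge> 1" and Y: "Y = basis bc p xs"
    and v: "v \<in> carrier_vec (length Y)"
    and m: "m = scalar_prod v (mass_matrix a b Y *\<^sub>v v)"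
    and d: "d = scalar_prod v (weak_laplacian a b Y *\<^sub>v v)"
  shows "m \<ge> 0" "d \<ge> 0" "v \<noteq> 0\<^sub>v (length Y) \<Longrightarrow> m > 0"
    "(min_length xs)\<^sup>2 * d \<le> 12 * real p ^ 4 * m"
    "bc = Dirichlet \<Longrightarrow> m \<le> (b - a)\<^sup>2 / pi\<^sup>2 * d"
proof -
  define N n where "N = length Y" and "n = ncells xs"
  note nodes = subdivision_nodes[OF sub, folded n_def]
  have "\<exists>r. degree r \<le> p \<and> (\<forall>x\<in>{xs ! (c - 1)..xs ! c}. (Y ! i) x = poly r x)"
    if "i < N" "c \<in> {1..n}" for i c
    using basis_on_cell[OF sub assms(2), of "Y ! i" bc c] that by (simp add: Y N_def n_def)
  then obtain q where q: "\<And>i c. i < N \<Longrightarrow> c \<in> {1..n} \<Longrightarrow>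
      degree (q i c) \<le> p \<and> (\<forall>x\<in>{xs ! (c - 1)..xs ! c}. (Y ! i) x = poly (q i c) x)"
    by metis
  define Q where "Q c = (\<Sum>i<N. Polynomial.smult (v $ i) (q i c))" for c
  define u where "u x = (\<Sum>i<N. v $ i * (Y ! i) x)" for x
  have Q_eq: "poly (Q c) x = u x" if "c \<in> {1..n}" "x \<in> {xs ! (c - 1)..xs ! c}" for c x
    using q that by (auto simp: Q_def u_def poly_sum intro!: sum.cong)
  have Q_deg: "degree (Q c) \<le> p" if "c \<in> {1..n}" for c
    unfolding Q_def using q that by (intro degree_sum_le) (auto intro: order.trans[OF degree_smult_le])
  have cell: "xs ! (c - 1) < xs ! c" if "c \<in> {1..n}" for c
    using subdivision_cell[OF sub] that by (simp add: n_def)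

  have "mass_matrix a b Y $$ (i, j) = (\<Sum>c=1..n. pint (xs ! (c - 1)) (xs ! c) (q i c * q j c))"
    if "i < N" "j < N" for i j
  proof -
    have "integral {a..b} (\<lambda>x. (Y ! i) x * (Y ! j) x) =
        (\<Sum>c=1..n. pint (xs ! (c - 1)) (xs ! c) (q i c * q j c))"
      unfolding n_def using that q by (intro integral_subdivision[OF sub]) (simp add: n_def)
    then show ?thesis using that by (simp add: mass_matrix_def N_def)
  qed
  then have "scalar_prod v (mass_matrix a b Y *\<^sub>v v) =
      (\<Sum>i<N. \<Sum>j<N. v $ i * v $ j * (\<Sum>c=1..n. pint (xs ! (c - 1)) (xs ! c) (q i c * q j c)))"
    using v by (subst quadratic_form_sum[of _ N]) (auto simp: mass_matrix_def N_def)
  then have m_eq: "m = (\<Sum>c=1..n. pint (xs ! (c - 1)) (xs ! c) (Q c * Q c))"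
    unfolding pint_gram m Q_def .

  have "weak_laplacian a b Y $$ (i, j) =
      (\<Sum>c=1..n. pint (xs ! (c - 1)) (xs ! c) (pderiv (q i c) * pderiv (q j c)))"
    if "i < N" "j < N" for i j
  proof -
    have "deriv (Y ! i) x = poly (pderiv (q i c)) x"
      if "i < N" "c \<in> {1..n}" "x \<in> {xs ! (c - 1)<..<xs ! c}" for i c x
      using q[OF that(1,2)] that(3) by (intro deriv_eq_pderiv) auto
    then have "integral {a..b} (\<lambda>x. deriv (Y ! i) x * deriv (Y ! j) x) =
        (\<Sum>c=1..n. pint (xs ! (c - 1)) (xs ! c) (pderiv (q i c) * pderiv (q j c)))"
      unfolding n_def using that by (intro integral_subdivision[OF sub]) (simp add: n_def)
    then show ?thesis using that by (simp add: weak_laplacian_def N_def)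
  qed
  then have "scalar_prod v (weak_laplacian a b Y *\<^sub>v v) =
      (\<Sum>i<N. \<Sum>j<N. v $ i * v $ j *
        (\<Sum>c=1..n. pint (xs ! (c - 1)) (xs ! c) (pderiv (q i c) * pderiv (q j c))))"
    using v by (subst quadratic_form_sum[of _ N]) (auto simp: weak_laplacian_def N_def)
  then have d_eq: "d = (\<Sum>c=1..n. pint (xs ! (c - 1)) (xs ! c) (pderiv (Q c) * pderiv (Q c)))"
    unfolding pint_gram d Q_def pderiv_sum_smult .

  show nonneg: "m \<ge> 0" "d \<ge> 0" by (auto simp: m_eq d_eq intro!: sum_nonneg pint_square_nonneg)
  \<comment> \<open>Definiteness: vanishing m makes every \<open>Q c\<close> zero, hence u is zero
    on the whole interval, and independence of the basis finishes.\<close>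
  have "v = 0\<^sub>v N" if "m = 0"
  proof -
    have "Q c = 0" if "c \<in> {1..n}" for c
    proof -
      have "pint (xs ! (c - 1)) (xs ! c) (Q c * Q c) = 0"
        using \<open>m = 0\<close> that unfolding m_eq
        by (subst (asm) sum_nonneg_eq_0_iff) (auto intro!: pint_square_nonneg)
      then show ?thesis using pint_square_eq_0 cell[OF that] by blast
    qed
    moreover have "\<exists>c\<in>{1..n}. x \<in> {xs ! (c - 1)..xs ! c}" if "x \<in> {a..b}" for x
    proof -
      \<comment> \<open>The first cell whose right end is not left of x; minimality places its left
        end at or before x.\<close>
      define c where "c = (LEAST c. c \<ge> 1 \<and> x \<le> xs ! c)"
      have "n \<ge> 1 \<and> x \<le> xs ! n" using that nodes by auto
      then have c: "c \<ge> 1 \<and> x \<le> xs ! c" "c \<le> n"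
        unfolding c_def by (rule LeastI, rule Least_le)
      have "xs ! (c - 1) \<le> x"
      proof (cases "c = 1")
        case True
        then show ?thesis using that nodes by simp
      next
        case False
        then have "\<not> (c - 1 \<ge> 1 \<and> x \<le> xs ! (c - 1))"
          using c not_less_Least[of "c - 1" "\<lambda>c. c \<ge> 1 \<and> x \<le> xs ! c"] by (auto simp: c_def)
        then show ?thesis using c False by auto
      qed
      with c show ?thesis by auto
    qed
    ultimately have u: "u x = 0" if "x \<in> {a..b}" for x
      using Q_eq that by (metis poly_0)
    obtain l k where lk: "k \<le> Suc n" "Y = map (hat xs) [l..<k] @ bubbles p xs"
    proof (cases bc)
      case Neumann
      then show ?thesis using that[of "n + 1" 0] by (simp add: Y C_basis_def n_def)
    next
      case Dirichlet
      then show ?thesis using that[of n 1] by (simp add: Y Q_basis_def n_def)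
    qed
    have "v $ i = 0" if "i < N" for i
      using basis_independent[OF sub _ lk(2), of "\<lambda>i. v $ i" i] lk(1) u that
      by (simp add: n_def N_def u_def)
    then show ?thesis using v by (auto simp: N_def)
  qed
  then show "m > 0" if "v \<noteq> 0\<^sub>v (length Y)"
    using that nonneg by (fastforce simp: N_def)

  have "(min_length xs)\<^sup>2 * d = (\<Sum>c=1..n. (min_length xs)\<^sup>2 *
      pint (xs ! (c - 1)) (xs ! c) (pderiv (Q c) * pderiv (Q c)))"
    by (simp add: d_eq sum_distrib_left)
  also have "\<dots> \<le> (\<Sum>c=1..n. 12 * real p ^ 4 * pint (xs ! (c - 1)) (xs ! c) (Q c * Q c))"
  proof (rule sum_mono)
    fix c assume c: "c \<in> {1..n}"
    have "(min_length xs)\<^sup>2 * pint (xs ! (c - 1)) (xs ! c) (pderiv (Q c) * pderiv (Q c))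
        \<le> (xs ! c - xs ! (c - 1))\<^sup>2 * pint (xs ! (c - 1)) (xs ! c) (pderiv (Q c) * pderiv (Q c))"
      using min_length_bounds[OF sub] c
      by (intro mult_right_mono power_mono pint_square_nonneg) (auto simp: n_def less_imp_le)
    also have "\<dots> \<le> 12 * real p ^ 4 * pint (xs ! (c - 1)) (xs ! c) (Q c * Q c)"
      by (intro inverse_inequality Q_deg cell c assms(2))
    finally show "(min_length xs)\<^sup>2 * pint (xs ! (c - 1)) (xs ! c) (pderiv (Q c) * pderiv (Q c))
        \<le> 12 * real p ^ 4 * pint (xs ! (c - 1)) (xs ! c) (Q c * Q c)" .
  qed
  also have "\<dots> = 12 * real p ^ 4 * m" by (simp add: m_eq sum_distrib_left)
  finally show "(min_length xs)\<^sup>2 * d \<le> 12 * real p ^ 4 * m" .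

  show "m \<le> (b - a)\<^sup>2 / pi\<^sup>2 * d" if "bc = Dirichlet"
  proof -
    have "(Y ! i) a = 0" "(Y ! i) b = 0" if "i < N" for i
      using Dirichlet_basis_endpoints[OF sub, of "Y ! i" p] that \<open>bc = Dirichlet\<close> by (auto simp: Y N_def)
    then have "u a = 0" "u b = 0" by (auto simp: u_def)
    moreover have "poly (Q 1) (xs ! 0) = u (xs ! 0)" "poly (Q n) (xs ! n) = u (xs ! n)"
      using nodes(1) cell[of 1] cell[of n] by (auto intro!: Q_eq)
    \<comment> \<open>Continuity across a node: both local polynomials take the value of u
      there.\<close>
    moreover have "poly (Q c) (xs ! c) = poly (Q (Suc c)) (xs ! c)" if "c \<in> {1..<n}" for c
      using that cell[of c] cell[of "Suc c"] Q_eq[of c "xs ! c"] Q_eq[of "Suc c" "xs ! c"] by simp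
    ultimately show ?thesis
      using poincare[of n "(!) xs" Q] cell nodes(1-3) nodes(4)[of 0 n] by (simp add: m_eq d_eq)
  qed
qed

section \<open>Assembly of the spectral bounds\<close>

theorem lemma5p2:
  fixes a b \<omega> h :: real and p :: nat and \<T> :: "real list set" and xs :: "real list"
    and bc :: bdry_cond and Y :: "(real \<Rightarrow> real) list" and A M L :: "real mat"
  assumes "a < b"
    and "\<forall>ys\<in>\<T>. subdivision a b ys"
    and "quasi_uniform \<T>"
    and "xs \<in> \<T>"
    and "h = min_length xs"
    and "p \<ge> 1"
    and "bc = Neumann \<Longrightarrow> \<omega> \<noteq> 0"
    and "Y = basis bc p xs"
    and "Y \<noteq> []"
    and "M = mass_matrix a b Y"
    and "A = weak_laplacian a b Y + (\<omega>\<^sup>2 / 2) \<cdot>\<^sub>m M"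
    and "L \<in> carrier_mat (length Y) (length Y)"
    and "transpose_mat L * L = A"
  shows "invertible_mat L \<and>
    spectrum (map_mat complex_of_real (transpose_mat (inv_mat L) * M * inv_mat L))
      \<subseteq> complex_of_real ` {2 * h\<^sup>2 / (24 * real p ^ 4 + \<omega>\<^sup>2 * h\<^sup>2) .. upper_const bc a b \<omega>}"
proof (rule spectrum_generalized_bounds[OF assms(12)])
  have sub: "subdivision a b xs" using assms(2,4) by blast
  have h: "h > 0" unfolding assms(5) by (rule min_length_bounds[OF sub])
  show M: "M \<in> carrier_mat (length Y) (length Y)" by (simp add: assms(10) mass_matrix_def)
  show "transpose_mat M = M"
    by (rule eq_matI) (auto simp: assms(10) mass_matrix_def mult.commute)
  have W: "weak_laplacian a b Y \<in> carrier_mat (length Y) (length Y)"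
    by (simp add: weak_laplacian_def)
  have A: "A \<in> carrier_mat (length Y) (length Y)" using assms(11) M W by simp
  have A_form: "scalar_prod v (A *\<^sub>v v) =
      scalar_prod v (weak_laplacian a b Y *\<^sub>v v) + \<omega>\<^sup>2 / 2 * scalar_prod v (M *\<^sub>v v)"
    if "v \<in> carrier_vec (length Y)" for v
  proof -
    have "A $$ (i, j) = weak_laplacian a b Y $$ (i, j) + \<omega>\<^sup>2 / 2 * M $$ (i, j)"
      if "i < length Y" "j < length Y" for i j
      using that M W by (simp add: assms(11))
    then have "scalar_prod v (A *\<^sub>v v) = (\<Sum>i<length Y. \<Sum>j<length Y.
        v $ i * v $ j * weak_laplacian a b Y $$ (i, j) + \<omega>\<^sup>2 / 2 * (v $ i * v $ j * M $$ (i, j)))"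
      unfolding quadratic_form_sum[OF A that] by (simp add: algebra_simps)
    then show ?thesis
      unfolding quadratic_form_sum[OF M that] quadratic_form_sum[OF W that] sum.distrib
      by (simp only: sum_distrib_left)
  qed
  fix v :: "real vec" assume v: "v \<in> carrier_vec (length Y)"
  define m where "m = scalar_prod v (M *\<^sub>v v)"
  define d where "d = scalar_prod v (weak_laplacian a b Y *\<^sub>v v)"
  note forms = basis_quadratic_forms[OF sub assms(6,8) v m_def[unfolded assms(10)] d_def, folded assms(5)]
  have Av: "scalar_prod v ((transpose_mat L * L) *\<^sub>v v) = d + \<omega>\<^sup>2 / 2 * m"
    unfolding assms(13) A_form[OF v] m_def d_def ..
  show "scalar_prod v (M *\<^sub>v v) > 0" if "v \<noteq> 0\<^sub>v (length Y)"
    using forms(3)[OF that] by (simp add: m_def)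
  show "2 * h\<^sup>2 / (24 * real p ^ 4 + \<omega>\<^sup>2 * h\<^sup>2) * scalar_prod v ((transpose_mat L * L) *\<^sub>v v)
      \<le> scalar_prod v (M *\<^sub>v v)"
  proof -
    have "24 * real p ^ 4 + \<omega>\<^sup>2 * h\<^sup>2 > 0"
      using assms(6) by (intro add_pos_nonneg) auto
    \<comment> \<open>Twice the inverse inequality h^2 d <= 12 p^4 m; the terms with
      \<open>\<omega>\<^sup>2\<close> agree on both sides.\<close>
    moreover have "2 * h\<^sup>2 * (d + \<omega>\<^sup>2 / 2 * m) \<le> m * (24 * real p ^ 4 + \<omega>\<^sup>2 * h\<^sup>2)"
      using forms(4) by (simp add: algebra_simps)
    ultimately show ?thesis unfolding Av m_def[symmetric] by (simp add: pos_divide_le_eq)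
  qed
  \<comment> \<open>The zeroth-order term of A alone controls m, with factor 2/\<omega>^2; the term
    d is only added.\<close>
  have reaction: "m \<le> max 1 (2 / \<omega>\<^sup>2) * (d + \<omega>\<^sup>2 / 2 * m)" if "\<omega> \<noteq> 0"
  proof -
    have "m = 2 / \<omega>\<^sup>2 * (\<omega>\<^sup>2 / 2 * m)" using that by simp
    also have "\<dots> \<le> max 1 (2 / \<omega>\<^sup>2) * (d + \<omega>\<^sup>2 / 2 * m)"
      using forms(1,2) by (intro mult_mono) auto
    finally show ?thesis .
  qed
  have poincare': "m \<le> (b - a)\<^sup>2 / pi\<^sup>2 * (d + \<omega>\<^sup>2 / 2 * m)" if "bc = Dirichlet"
  proof -
    have "(b - a)\<^sup>2 / pi\<^sup>2 * d \<le> (b - a)\<^sup>2 / pi\<^sup>2 * (d + \<omega>\<^sup>2 / 2 * m)"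
      using forms(1,2) by (intro mult_left_mono) auto
    with forms(5)[OF that] show ?thesis by simp
  qed
  \<comment> \<open>In the Dirichlet case with \<omega> = 0 only the Poincare bound is available,
    matching the separate branch of \<open>upper_const\<close>; otherwise both bounds give the
    minimum.\<close>
  show "scalar_prod v (M *\<^sub>v v) \<le> upper_const bc a b \<omega> * scalar_prod v ((transpose_mat L * L) *\<^sub>v v)"
    unfolding Av m_def[symmetric] using assms(7) reaction poincare' by (cases bc) (auto simp: min_def)
qed

end
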